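(* Let $r$ be a set of rank conditions with dimension vector $(e_0,\dots,e_n)$ and let $0\le i<n$ with $e_i\ge1$ and $e_{i+1}\ge1$. If one substitutes $a^{i+1}_1=b^i_1=c$ in $K_r(a;b)$, the result is independent of $c$.
   Context: Rank conditions: for $n\ge1$, a family $r=\{r_{ij}\}_{0\le i\le j\le n}$ of non-negative integers with $r_{ij}\le\min(r_{i,j-1},r_{i+1,j})$ for $i<j$ and $r_{ij}+r_{i-1,j+1}\ge r_{i-1,j}+r_{i,j+1}$ for $0<i\le j<n$. Dimension vector $e_i=r_{ii}$; extend by $r_{ij}=e_j+\dots+e_i$ for $j\le i$ and $r_{ij}=0$ if $i<0$ or $j>n$; $N=e_0+\dots+e_n$. Permutations: $S_k$ on $\{1,\dots,k\}$, $(uv)(p)=u(v(p))$, $s_i=(i,i+1)$, $w_0^{(k)}$ longest element of $S_k$. For $0\le i<n$, $0<j\le n$, $W_{ij}\in S_{r_{i+1,j-1}}$: $W_{ij}(p)=p+r_{i,j-1}-r_{ij}$ if $r_{ij}<p\le r_{i+1,j}$; $=p-r_{i+1,j}+r_{ij}$ if $r_{i+1,j}<p\le r_{i+1,j}+r_{i,j-1}-r_{ij}$; $=p$ otherwise. $z(r)=\prod_{j=1}^n\prod_{i=0}^{n-1}W_{ij}=(W_{01}\cdots W_{n-1,1})\cdots(W_{0n}\cdots W_{n-1,n})\in S_N$, $\widehat z(r)=w_0^{(N)}z(r)^{-1}w_0^{(N)}$; with $r^e_{ij}=\min(e_i,\dots,e_j)$, $\widehat z(e)=\widehat z(r^e)$.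 Grothendieck polynomials: for $w\in S_N$, $\mathfrak G_w(a_1..a_N;b_1..b_N)$ is determined by $\mathfrak G_{w_0^{(N)}}=\prod_{p+q\le N}(1-b_p/a_q)$ and, when $w(i)<w(i+1)$, $(a_i-a_{i+1})\mathfrak G_w(a;b)=a_i\mathfrak G_{ws_i}(a;b)-a_{i+1}\mathfrak G_{ws_i}(a_{s_i};b)$ ($a_{s_i}$: $a_i,a_{i+1}$ swapped). Double quiver polynomial: with blocks $a^i=(a^i_1..a^i_{e_i})$, $b^i=(b^i_1..b^i_{e_i})$, $\breve a=(a^n,\dots,a^0)$ and $b=(b^0,\dots,b^n)$ (concatenations), $K_r(a;b)=\mathfrak G_{\widehat z(r)}(\breve a;b)/\mathfrak G_{\widehat z(e)}(\breve a;b)$, where $\mathfrak G_w(\breve a;b)$ means the first argument list is $\breve a$ and the second is $b$. *)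

theory Defs
  imports
    "HOL-Library.Countable"
    "HOL-Library.Poly_Mapping"
    "HOL-Computational_Algebra.Fraction_Field"
    "HOL-Combinatorics.Permutations"
begin

section \<open>Rational functions\<close>

text \<open>
  \<^term>\<open>VarA\<close> and \<^term>\<open>VarB\<close> are the two alphabets \<open>a\<close> and \<open>b\<close>; \<^term>\<open>VarC\<close> is the additional
  indeterminate \<open>c\<close>. The index type is \<^typ>\<open>nat\<close> for Grothendieck polynomials and
  \<^typ>\<open>nat \<times> nat\<close> (block, position within the block, positions starting at 1) for quiver
  polynomials.
\<close>

datatype 'i var = VarA 'i | VarB 'i | VarC

instance var :: (countable) countable
  by countable_datatype

text \<open>
  The order on variables has no mathematical meaning: the library needs some linear order on the
  variables in order to show that the polynomial ring is an integral domain.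
\<close>

instantiation var :: (countable) linorder
begin

definition less_eq_var :: "'a var \<Rightarrow> 'a var \<Rightarrow> bool" where
  "less_eq_var x y \<longleftrightarrow> to_nat x \<le> to_nat y"

definition less_var :: "'a var \<Rightarrow> 'a var \<Rightarrow> bool" where
  "less_var x y \<longleftrightarrow> to_nat x < to_nat y"

instance
  by standard (auto simp: less_eq_var_def less_var_def)

end

text \<open>Polynomials over the integers, and their field of fractions.\<close>

type_synonym 'v mpoly = "('v \<Rightarrow>\<^sub>0 nat) \<Rightarrow>\<^sub>0 int"

type_synonym 'v ratfun = "'v mpoly fract"

definition rvar :: "'v::linorder \<Rightarrow> 'v ratfun" where
  "rvar v = Fract (Poly_Mapping.single (Poly_Mapping.single v 1) 1) 1"

definition mpoly_vars :: "'v mpoly \<Rightarrow> 'v set" where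
  "mpoly_vars p = (\<Union>m\<in>Poly_Mapping.keys p. Poly_Mapping.keys m)"

definition mpoly_eval :: "('v \<Rightarrow> 'k::field) \<Rightarrow> 'v mpoly \<Rightarrow> 'k" where
  "mpoly_eval f p =
    (\<Sum>m\<in>Poly_Mapping.keys p. of_int (Poly_Mapping.lookup p m) *
      (\<Prod>v\<in>Poly_Mapping.keys m. f v ^ Poly_Mapping.lookup m v))"

text \<open>
  A substitution can be performed in a rational function if the latter can be written as a
  fraction whose denominator does not become zero; the result does not depend on the fraction.
\<close>

definition ratfun_subst_defined :: "('v::linorder \<Rightarrow> 'k::field) \<Rightarrow> 'v ratfun \<Rightarrow> bool" where
  "ratfun_subst_defined f x \<longleftrightarrow> (\<exists>p q. x = Fract p q \<and> mpoly_eval f q \<noteq> 0)"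

definition ratfun_subst :: "('v::linorder \<Rightarrow> 'k::field) \<Rightarrow> 'v ratfun \<Rightarrow> 'k" where
  "ratfun_subst f x =
    (THE y. \<exists>p q. x = Fract p q \<and> mpoly_eval f q \<noteq> 0 \<and> y = mpoly_eval f p / mpoly_eval f q)"

definition independent_of :: "'v::linorder \<Rightarrow> 'v ratfun \<Rightarrow> bool" where
  "independent_of v x \<longleftrightarrow>
    (\<exists>p q. q \<noteq> 0 \<and> x = Fract p q \<and> v \<notin> mpoly_vars p \<and> v \<notin> mpoly_vars q)"


section \<open>Double Grothendieck polynomials\<close>

text \<open>An element of the symmetric group on \<open>{1..k}\<close> is a function \<^term>\<open>w\<close> with \<^prop>\<open>w permutes {1..k}\<close>;
  in particular it is the identity outside \<open>{1..k}\<close>.\<close>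

definition longest_perm :: "nat \<Rightarrow> nat \<Rightarrow> nat" where
  "longest_perm k p = (if 1 \<le> p \<and> p \<le> k then k + 1 - p else p)"

definition swap_a :: "nat \<Rightarrow> nat var ratfun \<Rightarrow> nat var ratfun" where
  "swap_a i =
    ratfun_subst (\<lambda>v. case v of VarA p \<Rightarrow> rvar (VarA (transpose i (i + 1) p)) | _ \<Rightarrow> rvar v)"

definition grothendieck_family :: "nat \<Rightarrow> ((nat \<Rightarrow> nat) \<Rightarrow> nat var ratfun) \<Rightarrow> bool" where
  "grothendieck_family N G \<longleftrightarrow>
    G (longest_perm N) =
      (\<Prod>(p, q)\<in>{(p, q). 1 \<le> p \<and> 1 \<le> q \<and> p + q \<le> N}. 1 - rvar (VarB p) / rvar (VarA q)) \<and>
    (\<forall>w i. w permutes {1..N} \<and> 1 \<le> i \<and> i < N \<and> w i < w (i + 1) \<longrightarrow>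
      (rvar (VarA i) - rvar (VarA (i + 1))) * G w =
        rvar (VarA i) * G (w \<circ> transpose i (i + 1)) -
        rvar (VarA (i + 1)) * swap_a i (G (w \<circ> transpose i (i + 1))))"

text \<open>A family as above is unique only on the permutations of \<open>{1..N}\<close>.\<close>

definition grothendieck :: "nat \<Rightarrow> (nat \<Rightarrow> nat) \<Rightarrow> nat var ratfun" where
  "grothendieck N w = (THE g. \<exists>G. grothendieck_family N G \<and> g = G w)"

definition grothendieck_at ::
    "(nat \<Rightarrow> nat) \<Rightarrow> 'k::field list \<Rightarrow> 'k list \<Rightarrow> 'k" where
  "grothendieck_at w as bs =
    ratfun_subst (\<lambda>v. case v of VarA p \<Rightarrow> as ! (p - 1) | VarB p \<Rightarrow> bs ! (p - 1) | VarC \<Rightarrow> 0)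
      (grothendieck (length as) w)"


section \<open>Rank conditions and the associated permutations\<close>

text \<open>
  Indices are natural numbers, since no negative index occurs in the definition of \<open>W_perm\<close>.
  Only the values \<open>r i j\<close> with \<open>i \<le> j \<le> n\<close> are relevant.
\<close>

definition rank_conditions :: "nat \<Rightarrow> (nat \<Rightarrow> nat \<Rightarrow> nat) \<Rightarrow> bool" where
  "rank_conditions n r \<longleftrightarrow>
    1 \<le> n \<and>
    (\<forall>i j. i < j \<and> j \<le> n \<longrightarrow> r i j \<le> min (r i (j - 1)) (r (i + 1) j)) \<and>
    (\<forall>i j. 0 < i \<and> i \<le> j \<and> j < n \<longrightarrow>
      r i j + r (i - 1) (j + 1) \<ge> r (i - 1) j + r i (j + 1))"

definition dim_vec :: "(nat \<Rightarrow> nat \<Rightarrow> nat) \<Rightarrow> nat \<Rightarrow> nat" where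
  "dim_vec r i = r i i"

definition rank_ext :: "nat \<Rightarrow> (nat \<Rightarrow> nat \<Rightarrow> nat) \<Rightarrow> nat \<Rightarrow> nat \<Rightarrow> nat" where
  "rank_ext n r i j =
    (if j > n then 0 else if j \<le> i then (\<Sum>k=j..i. dim_vec r k) else r i j)"

definition total_dim :: "nat \<Rightarrow> (nat \<Rightarrow> nat \<Rightarrow> nat) \<Rightarrow> nat" where
  "total_dim n r = (\<Sum>i=0..n. dim_vec r i)"

definition W_perm :: "nat \<Rightarrow> (nat \<Rightarrow> nat \<Rightarrow> nat) \<Rightarrow> nat \<Rightarrow> nat \<Rightarrow> nat \<Rightarrow> nat" where
  "W_perm n r i j p =
    (let R = rank_ext n r in
     if R i j < p \<and> p \<le> R (i + 1) j then p + R i (j - 1) - R i j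
     else if R (i + 1) j < p \<and> p \<le> R (i + 1) j + R i (j - 1) - R i j then p - R (i + 1) j + R i j
     else p)"

text \<open>The outer index \<open>j\<close> and the inner index \<open>i\<close> increase from left to right.\<close>

definition z_perm :: "nat \<Rightarrow> (nat \<Rightarrow> nat \<Rightarrow> nat) \<Rightarrow> nat \<Rightarrow> nat" where
  "z_perm n r = foldr (\<circ>) [W_perm n r i j. j \<leftarrow> [1..<n + 1], i \<leftarrow> [0..<n]] id"

definition zhat_perm :: "nat \<Rightarrow> (nat \<Rightarrow> nat \<Rightarrow> nat) \<Rightarrow> nat \<Rightarrow> nat" where
  "zhat_perm n r =
    longest_perm (total_dim n r) \<circ> inv (z_perm n r) \<circ> longest_perm (total_dim n r)"

definition max_ranks :: "(nat \<Rightarrow> nat) \<Rightarrow> nat \<Rightarrow> nat \<Rightarrow> nat" where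
  "max_ranks e i j = Min (e ` {i..j})"


section \<open>Double quiver polynomials\<close>

definition a_block :: "(nat \<Rightarrow> nat) \<Rightarrow> nat \<Rightarrow> (nat \<times> nat) var ratfun list" where
  "a_block e i = map (\<lambda>p. rvar (VarA (i, p))) [1..<e i + 1]"

definition b_block :: "(nat \<Rightarrow> nat) \<Rightarrow> nat \<Rightarrow> (nat \<times> nat) var ratfun list" where
  "b_block e i = map (\<lambda>p. rvar (VarB (i, p))) [1..<e i + 1]"

definition quiver_poly :: "nat \<Rightarrow> (nat \<Rightarrow> nat \<Rightarrow> nat) \<Rightarrow> (nat \<times> nat) var ratfun" where
  "quiver_poly n r =
    (let e = dim_vec r;
         as = concat (map (a_block e) (rev [0..<n + 1]));
         bs = concat (map (b_block e) [0..<n + 1])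
     in grothendieck_at (zhat_perm n r) as bs /
        grothendieck_at (zhat_perm n (max_ranks e)) as bs)"

end

theory Submission
  imports Defs
begin

text \<open>
  Put \<open>x = e\<^sub>n + \<dots> + e\<^bsub>i+2\<^esub> + 1\<close> and \<open>y = e\<^sub>0 + \<dots> + e\<^bsub>i-1\<^esub> + 1\<close>, the positions of the two variables
  that are specialized to \<open>c\<close>. The permutations \<open>w\<close> attached to \<open>r\<close> and to \<open>e\<close> satisfy
  \<open>w q > y\<close> for \<open>q < x\<close> and \<open>w x \<ge> y\<close>. Downward induction on any such \<open>w\<close> along the defining recursion
  shows that \<open>G\<^sub>w\<close> vanishes at \<open>a\<^sub>x = b\<^sub>y\<close> if \<open>w x > y\<close>, and that for \<open>w x = y\<close> the specialization of
  \<open>G\<^sub>w\<close> is the product of all \<open>1 - c / a\<^sub>q\<close> (\<open>q < x\<close>) and \<open>1 - b\<^sub>p / c\<close> (\<open>p < y\<close>) with a factor that is free of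
  \<open>c\<close>. The permutation of \<open>e\<close> is of the second kind, so in the quotient the factors containing \<open>c\<close>
  cancel. The denominator does not vanish: if all other \<open>b\<^sub>p\<close> are set to \<open>0\<close>, its factor free of \<open>c\<close>
  becomes \<open>1\<close>.
\<close>

section \<open>Substitution in rational functions\<close>

definition mono_eval :: "('v \<Rightarrow> 'k::field) \<Rightarrow> ('v \<Rightarrow>\<^sub>0 nat) \<Rightarrow> 'k" where
  "mono_eval f m = (\<Prod>v\<in>Poly_Mapping.keys m. f v ^ Poly_Mapping.lookup m v)"

text \<open>Exponents 0 contribute only factors 1, so two monomials can be compared over the union
  of their supports.\<close>

lemma mono_eval_superset:
  assumes "finite S" "Poly_Mapping.keys m \<subseteq> S"
  shows "mono_eval f m = (\<Prod>v\<in>S. f v ^ Poly_Mapping.lookup m v)"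
  unfolding mono_eval_def using assms
  by (intro prod.mono_neutral_left) (auto simp: in_keys_iff)

lemma mono_eval_add: "mono_eval f (m + m') = mono_eval f m * mono_eval f m'"
proof -
  let ?S = "Poly_Mapping.keys m \<union> Poly_Mapping.keys m'"
  have "Poly_Mapping.keys (m + m') \<subseteq> ?S" by (rule Poly_Mapping.keys_add)
  then show ?thesis
    by (simp add: mono_eval_superset[where S = ?S] lookup_add power_add prod.distrib)
qed

lemma mpoly_eval_superset:
  assumes "finite S" "Poly_Mapping.keys p \<subseteq> S"
  shows "mpoly_eval f p = (\<Sum>m\<in>S. of_int (Poly_Mapping.lookup p m) * mono_eval f m)"
  unfolding mpoly_eval_def mono_eval_def[symmetric] using assms
  by (intro sum.mono_neutral_left) (auto simp: in_keys_iff)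

lemma mpoly_eval_add: "mpoly_eval f (p + q) = mpoly_eval f p + mpoly_eval f q"
proof -
  let ?S = "Poly_Mapping.keys p \<union> Poly_Mapping.keys q"
  have "Poly_Mapping.keys (p + q) \<subseteq> ?S" by (rule Poly_Mapping.keys_add)
  then show ?thesis
    by (simp add: mpoly_eval_superset[where S = ?S] lookup_add sum.distrib algebra_simps)
qed

lemma mpoly_eval_0 [simp]: "mpoly_eval f 0 = 0"
  by (simp add: mpoly_eval_def)

lemma mpoly_eval_single:
  "mpoly_eval f (Poly_Mapping.single m c) = of_int c * mono_eval f m"
  by (simp add: mpoly_eval_def mono_eval_def)

lemma mpoly_eval_1 [simp]: "mpoly_eval f 1 = 1"
  by (simp add: mpoly_eval_single mono_eval_def flip: single_one)

lemma mpoly_eval_uminus: "mpoly_eval f (- p) = - mpoly_eval f p"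
  using mpoly_eval_add[of f p "- p"] by (simp add: eq_neg_iff_add_eq_0 add.commute)

lemma mpoly_eval_mult:
  "mpoly_eval f (p * q) = mpoly_eval f p * (mpoly_eval f q :: 'k::field)"
proof -
  \<comment> \<open>Adjoining a new monomial is an addition, so distributivity reduces the claim to
    single monomials, first in \<open>q\<close> and then in \<open>p\<close>.\<close>
  have update_eq: "Poly_Mapping.update m c p = p + Poly_Mapping.single m c"
    if "m \<notin> Poly_Mapping.keys p" for m c and p :: "'v mpoly"
    using that by (intro poly_mapping_eqI) (auto simp: lookup_update lookup_add lookup_single in_keys_iff)
  have single: "mpoly_eval f (Poly_Mapping.single m c * q) =
      mpoly_eval f (Poly_Mapping.single m c) * mpoly_eval f q" for m c
  proof (induction q rule: update_induct)
    case const
    show ?case by simp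
  next
    case (update q m' c')
    then show ?case
      by (simp add: update_eq distrib_left mpoly_eval_add mult_single mpoly_eval_single mono_eval_add)
  qed
  show ?thesis
  proof (induction p rule: update_induct)
    case const
    show ?case by simp
  next
    case (update p m c)
    then show ?case by (simp add: update_eq distrib_right mpoly_eval_add single)
  qed
qed

section \<open>Well-definedness and homomorphism properties of substitution\<close>

lemma ratfun_subst_eqI:
  assumes "x = Fract p q" "mpoly_eval f q \<noteq> 0"
  shows "ratfun_subst f x = mpoly_eval f p / mpoly_eval f q"
  unfolding ratfun_subst_def
proof (rule the_equality)
  show "\<exists>p' q'. x = Fract p' q' \<and> mpoly_eval f q' \<noteq> 0 \<and>
      mpoly_eval f p / mpoly_eval f q = mpoly_eval f p' / mpoly_eval f q'"
    using assms by blast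
next
  fix y
  assume "\<exists>p' q'. x = Fract p' q' \<and> mpoly_eval f q' \<noteq> 0 \<and> y = mpoly_eval f p' / mpoly_eval f q'"
  then obtain p' q' where *: "x = Fract p' q'" "mpoly_eval f q' \<noteq> 0"
    "y = mpoly_eval f p' / mpoly_eval f q'" by blast
  have "q \<noteq> 0" "q' \<noteq> 0" using assms * by auto
  \<comment> \<open>Two representations of one fraction agree after cross-multiplication, and
    evaluation respects products; hence the description in \<open>ratfun_subst\<close> has a single
    value.\<close>
  then have "p * q' = p' * q" using assms(1) *(1) by (simp add: eq_fract)
  then have "mpoly_eval f p * mpoly_eval f q' = mpoly_eval f p' * mpoly_eval f q"
    by (metis mpoly_eval_mult)
  then show "y = mpoly_eval f p / mpoly_eval f q"
    unfolding *(3) using *(2) assms(2) by (simp add: frac_eq_eq)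
qed

lemma ratfun_subst_definedE:
  assumes "ratfun_subst_defined f x"
  obtains p q where "x = Fract p q" "q \<noteq> 0" "mpoly_eval f q \<noteq> 0"
    "ratfun_subst f x = mpoly_eval f p / mpoly_eval f q"
  using assms ratfun_subst_eqI mpoly_eval_0 unfolding ratfun_subst_defined_def by metis

text \<open>Definedness and value are carried together from here on: the value is a definite
  description and says nothing unless a fraction with non-vanishing denominator exists.\<close>

lemma ratfun_substI:
  assumes "x = Fract p q" "mpoly_eval f q \<noteq> 0" "y = mpoly_eval f p / mpoly_eval f q"
  shows "ratfun_subst_defined f x \<and> ratfun_subst f x = y"
  using assms ratfun_subst_eqI unfolding ratfun_subst_defined_def by blast

lemma ratfun_subst_0: "ratfun_subst_defined f 0 \<and> ratfun_subst f 0 = 0"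
  by (rule ratfun_substI[of _ 0 1]) (simp_all add: Zero_fract_def)

lemma ratfun_subst_1: "ratfun_subst_defined f 1 \<and> ratfun_subst f 1 = 1"
  by (rule ratfun_substI[of _ 1 1]) (simp_all add: One_fract_def)

lemma ratfun_subst_rvar: "ratfun_subst_defined f (rvar v) \<and> ratfun_subst f (rvar v) = f v"
  by (rule ratfun_substI[OF rvar_def]) (simp_all add: mpoly_eval_single mono_eval_def)

lemma ratfun_subst_diff:
  assumes "ratfun_subst_defined f x" "ratfun_subst_defined f y"
  shows "ratfun_subst_defined f (x - y) \<and>
    ratfun_subst f (x - y) = ratfun_subst f x - ratfun_subst f y"
proof -
  obtain p q where x: "x = Fract p q" "q \<noteq> 0" "mpoly_eval f q \<noteq> 0"
    "ratfun_subst f x = mpoly_eval f p / mpoly_eval f q"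
    using assms(1) by (rule ratfun_subst_definedE)
  obtain p' q' where y: "y = Fract p' q'" "q' \<noteq> 0" "mpoly_eval f q' \<noteq> 0"
    "ratfun_subst f y = mpoly_eval f p' / mpoly_eval f q'"
    using assms(2) by (rule ratfun_subst_definedE)
  have "x - y = Fract (p * q' + - (p' * q)) (q * q')" using x y by simp
  then show ?thesis
    by (rule ratfun_substI) (use x y in \<open>simp_all only: mpoly_eval_add mpoly_eval_uminus mpoly_eval_mult,
      simp_all add: field_simps\<close>)
qed

lemma ratfun_subst_mult:
  assumes "ratfun_subst_defined f x" "ratfun_subst_defined f y"
  shows "ratfun_subst_defined f (x * y) \<and>
    ratfun_subst f (x * y) = ratfun_subst f x * ratfun_subst f y"
proof -
  obtain p q where x: "x = Fract p q" "q \<noteq> 0" "mpoly_eval f q \<noteq> 0"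
    "ratfun_subst f x = mpoly_eval f p / mpoly_eval f q"
    using assms(1) by (rule ratfun_subst_definedE)
  obtain p' q' where y: "y = Fract p' q'" "q' \<noteq> 0" "mpoly_eval f q' \<noteq> 0"
    "ratfun_subst f y = mpoly_eval f p' / mpoly_eval f q'"
    using assms(2) by (rule ratfun_subst_definedE)
  have "x * y = Fract (p * p') (q * q')" using x y by simp
  then show ?thesis
    by (rule ratfun_substI) (use x y in \<open>simp_all add: mpoly_eval_mult\<close>)
qed

lemma ratfun_subst_divide:
  assumes "ratfun_subst_defined f x" "ratfun_subst_defined f y" "ratfun_subst f y \<noteq> 0"
  shows "ratfun_subst_defined f (x / y) \<and>
    ratfun_subst f (x / y) = ratfun_subst f x / ratfun_subst f y"
proof -
  obtain p q where x: "x = Fract p q" "q \<noteq> 0" "mpoly_eval f q \<noteq> 0"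
    "ratfun_subst f x = mpoly_eval f p / mpoly_eval f q"
    using assms(1) by (rule ratfun_subst_definedE)
  obtain p' q' where y: "y = Fract p' q'" "q' \<noteq> 0" "mpoly_eval f q' \<noteq> 0"
    "ratfun_subst f y = mpoly_eval f p' / mpoly_eval f q'"
    using assms(2) by (rule ratfun_subst_definedE)
  have "x / y = Fract (p * q') (q * p')" using x y by simp
  then show ?thesis
    by (rule ratfun_substI) (use x y assms(3) in \<open>simp_all add: mpoly_eval_mult\<close>)
qed

lemma ratfun_subst_prod:
  assumes "\<And>x. x \<in> S \<Longrightarrow> ratfun_subst_defined f (g x)"
  shows "ratfun_subst_defined f (\<Prod>x\<in>S. g x) \<and>
    ratfun_subst f (\<Prod>x\<in>S. g x) = (\<Prod>x\<in>S. ratfun_subst f (g x))"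
  using assms
  by (induction S rule: infinite_finite_induct) (simp_all add: ratfun_subst_1 ratfun_subst_mult)

lemma rvar_nonzero [simp]: "rvar v \<noteq> 0"
proof -
  have "Poly_Mapping.single (Poly_Mapping.single v 1) 1 \<noteq> (0 :: 'a mpoly)"
    by (metis keys_single keys_zero insert_not_empty zero_neq_one)
  then show ?thesis by (simp add: rvar_def Zero_fract_def eq_fract)
qed

lemma rvar_eq_iff [simp]: "rvar v = rvar w \<longleftrightarrow> v = w"
proof
  assume "rvar v = rvar w"
  then have "Poly_Mapping.single (Poly_Mapping.single v 1) 1 =
      (Poly_Mapping.single (Poly_Mapping.single w 1) 1 :: 'a mpoly)"
    by (simp add: rvar_def eq_fract)
  then have "{Poly_Mapping.single v (1::nat)} = {Poly_Mapping.single w 1}"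
    by (metis keys_single zero_neq_one)
  then have "Poly_Mapping.single v (1::nat) = Poly_Mapping.single w 1" by simp
  then have "{v} = {w}"
    by (metis keys_single zero_neq_one)
  then show "v = w" by simp
qed simp

section \<open>Rational functions free of a given variable\<close>

lemma mpoly_vars_mult: "mpoly_vars (p * q) \<subseteq> mpoly_vars p \<union> mpoly_vars q"
proof
  fix v assume "v \<in> mpoly_vars (p * q)"
  then obtain m where m: "m \<in> Poly_Mapping.keys (p * q)" "v \<in> Poly_Mapping.keys m"
    by (auto simp: mpoly_vars_def)
  then obtain m1 m2 where "m = m1 + m2" "m1 \<in> Poly_Mapping.keys p" "m2 \<in> Poly_Mapping.keys q"
    using keys_mult[of p q] by auto
  then show "v \<in> mpoly_vars p \<union> mpoly_vars q"
    using m Poly_Mapping.keys_add[of m1 m2] by (auto simp: mpoly_vars_def)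
qed

lemma mpoly_vars_diff: "mpoly_vars (p - q) \<subseteq> mpoly_vars p \<union> mpoly_vars q"
  using keys_diff[of p q] by (auto simp: mpoly_vars_def)

lemma independent_of_0: "independent_of v 0"
  unfolding independent_of_def
  by (rule exI[of _ 0], rule exI[of _ 1]) (simp_all add: Zero_fract_def mpoly_vars_def)

lemma independent_of_1: "independent_of v 1"
  unfolding independent_of_def
  by (rule exI[of _ 1], rule exI[of _ 1]) (simp_all add: One_fract_def mpoly_vars_def)

lemma independent_of_rvar: "v \<noteq> w \<Longrightarrow> independent_of v (rvar w)"
  unfolding independent_of_def rvar_def
  by (intro exI conjI, rule one_neq_zero, rule refl) (auto simp: mpoly_vars_def)

lemma independent_of_diff:
  assumes "independent_of v x" "independent_of v y"
  shows "independent_of v (x - y)"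
proof -
  obtain p q p' q' where "x = Fract p q" "q \<noteq> 0" "v \<notin> mpoly_vars p" "v \<notin> mpoly_vars q"
      "y = Fract p' q'" "q' \<noteq> 0" "v \<notin> mpoly_vars p'" "v \<notin> mpoly_vars q'"
    using assms unfolding independent_of_def by blast
  moreover from this have "x - y = Fract (p * q' - p' * q) (q * q')" by simp
  ultimately show ?thesis
    unfolding independent_of_def
    by (intro exI[of _ "p * q' - p' * q"] exI[of _ "q * q'"])
      (use mpoly_vars_mult[of p q'] mpoly_vars_mult[of p' q] mpoly_vars_mult[of q q']
        mpoly_vars_diff[of "p * q'" "p' * q"] in auto)
qed

lemma independent_of_mult:
  assumes "independent_of v x" "independent_of v y"
  shows "independent_of v (x * y)"
proof -
  obtain p q p' q' where "x = Fract p q" "q \<noteq> 0" "v \<notin> mpoly_vars p" "v \<notin> mpoly_vars q"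
      "y = Fract p' q'" "q' \<noteq> 0" "v \<notin> mpoly_vars p'" "v \<notin> mpoly_vars q'"
    using assms unfolding independent_of_def by blast
  then show ?thesis
    unfolding independent_of_def
    by (intro exI[of _ "p * p'"] exI[of _ "q * q'"])
      (use mpoly_vars_mult[of p p'] mpoly_vars_mult[of q q'] in auto)
qed

lemma independent_of_divide:
  assumes "independent_of v x" "independent_of v y"
  shows "independent_of v (x / y)"
proof (cases "y = 0")
  case True
  \<comment> \<open>Division by zero yields \<open>0\<close>, which is free of every
    variable.\<close>
  then show ?thesis by (simp add: independent_of_0)
next
  case False
  obtain p q where "y = Fract p q" "q \<noteq> 0" "v \<notin> mpoly_vars p" "v \<notin> mpoly_vars q"
    using assms unfolding independent_of_def by blast
  moreover from this False have "p \<noteq> 0" by (auto simp: fract_collapse)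
  ultimately have "independent_of v (inverse y)"
    unfolding independent_of_def by (intro exI[of _ q] exI[of _ p]) simp
  then show ?thesis
    using independent_of_mult[OF assms(1)] by (simp add: divide_inverse)
qed

lemma independent_of_prod:
  "(\<And>x. x \<in> S \<Longrightarrow> independent_of v (g x)) \<Longrightarrow> independent_of v (\<Prod>x\<in>S. g x)"
  by (induction S rule: infinite_finite_induct)
    (simp_all add: independent_of_1 independent_of_mult)

section \<open>The permutations of a set of rank conditions\<close>

lemma longest_perm_permutes: "longest_perm k permutes {1..k}"
proof (rule bij_imp_permutes)
  show "bij_betw (longest_perm k) {1..k} {1..k}"
    by (rule bij_betw_byWitness[where f' = "longest_perm k"]) (auto simp: longest_perm_def)
qed (auto simp: longest_perm_def)

section \<open>Partial products of \<open>z_perm\<close>\<close>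

definition column_perm :: "nat \<Rightarrow> (nat \<Rightarrow> nat \<Rightarrow> nat) \<Rightarrow> nat \<Rightarrow> nat \<Rightarrow> nat \<Rightarrow> nat" where
  "column_perm n r j m = foldr (\<circ>) (map (\<lambda>i. W_perm n r i j) [0..<m]) id"

text \<open>The rightmost factor of a composition acts first, so a position passes through the
  columns in order of decreasing index; truncation at \<open>m\<close> isolates the columns that act
  last.\<close>

definition columns_perm :: "nat \<Rightarrow> (nat \<Rightarrow> nat \<Rightarrow> nat) \<Rightarrow> nat \<Rightarrow> nat \<Rightarrow> nat" where
  "columns_perm n r m = foldr (\<circ>) (map (\<lambda>j. column_perm n r j n) [1..<m + 1]) id"

lemma foldr_comp_eq: "foldr (\<circ>) fs g = foldr (\<circ>) fs id \<circ> g"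
  by (induction fs) (simp_all add: comp_assoc)

lemma column_perm_0 [simp]: "column_perm n r j 0 = id"
  by (simp add: column_perm_def)

lemma column_perm_Suc [simp]: "column_perm n r j (Suc m) = column_perm n r j m \<circ> W_perm n r m j"
  by (simp add: column_perm_def foldr_comp_eq[of _ "W_perm n r m j"])

lemma columns_perm_0 [simp]: "columns_perm n r 0 = id"
  by (simp add: columns_perm_def)

lemma columns_perm_Suc [simp]:
  "columns_perm n r (Suc m) = columns_perm n r m \<circ> column_perm n r (Suc m) n"
proof -
  have "[1..<Suc m + 1] = [1..<m + 1] @ [Suc m]" by simp
  then show ?thesis
    unfolding columns_perm_def by (simp only: map_append foldr_append list.map foldr_Cons foldr_Nil)
      (simp add: foldr_comp_eq[of _ "column_perm n r (Suc m) n"])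
qed

lemma z_perm_eq_columns_perm: "z_perm n r = columns_perm n r n"
proof -
  have "foldr (\<circ>) (concat (map (\<lambda>j. map (\<lambda>i. W_perm n r i j) [0..<n]) js)) id =
      foldr (\<circ>) (map (\<lambda>j. column_perm n r j n) js) id" for js
  proof (induction js)
    case (Cons j js)
    have comp_Cons: "foldr (\<circ>) (f # fs) id = f \<circ> foldr (\<circ>) fs id" for f :: "nat \<Rightarrow> nat" and fs
      by (rule ext) simp
    show ?case
      unfolding list.map concat.simps foldr_append Cons column_perm_def comp_Cons by (rule foldr_comp_eq)
  qed simp
  then show ?thesis
    unfolding z_perm_def columns_perm_def by simp
qed

section \<open>Inequalities between the extended ranks\<close>

locale ranks =
  fixes n :: nat and r :: "nat \<Rightarrow> nat \<Rightarrow> nat"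
  assumes rank_conditions: "rank_conditions n r"
begin

abbreviation R :: "nat \<Rightarrow> nat \<Rightarrow> nat" where "R \<equiv> rank_ext n r"
abbreviation e :: "nat \<Rightarrow> nat" where "e \<equiv> dim_vec r"
abbreviation N :: nat where "N \<equiv> total_dim n r"

lemma R_diag: "j \<le> n \<Longrightarrow> R j j = e j"
  by (simp add: rank_ext_def)

text \<open>For \<open>j = Suc i\<close> the value \<open>R i j\<close> is a genuine rank above the
  diagonal and not an empty sum, hence the case distinction.\<close>

lemma R_low_Suc_left:
  assumes "j \<le> Suc i" "j \<le> n"
  shows "R (Suc i) j = (if j = Suc i then 0 else R i j) + e (Suc i)"
  using assms by (auto simp: rank_ext_def le_Suc_eq sum.nat_ivl_Suc')

lemma R_low_pred_right:
  assumes "1 \<le> j" "j \<le> Suc i" "j \<le> n"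
  shows "R i (j - 1) = (if j = Suc i then 0 else R i j) + e (j - 1)"
proof -
  have "{j - 1..i} = insert (j - 1) {j..i}" using assms by auto
  then show ?thesis using assms by (auto simp: rank_ext_def)
qed

text \<open>For \<open>j \<le> i\<close> the extended ranks are sums of dimensions and the third
  inequality is an equality; for \<open>j = Suc i\<close> the difference of its sides is
  \<open>r i j\<close>; beyond that it is the rank condition at \<open>(Suc i, j - 1)\<close>. It
  makes \<open>W_perm\<close> fit into \<open>{1..R (Suc i) (j - 1)}\<close>.\<close>

lemma R_rect:
  assumes "i < n" "1 \<le> j" "j \<le> n"
  shows R_le_Suc_left: "R i j \<le> R (Suc i) j"
    and R_le_pred_right: "R i j \<le> R i (j - 1)"
    and R_rect_le: "R (Suc i) j + R i (j - 1) \<le> R (Suc i) (j - 1) + R i j"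
proof -
  have mono: "r i j \<le> r i (j - 1)" "r i j \<le> r (Suc i) j" if "i < j"
    using rank_conditions that assms unfolding rank_conditions_def by auto
  have rect: "r (Suc i) j + r i (j - 1) \<le> r (Suc i) (j - 1) + r i j" if "Suc i < j"
  proof -
    have "0 < Suc i \<and> Suc i \<le> j - 1 \<and> j - 1 < n" using that assms by auto
    then have "r (Suc i) (j - 1) + r (Suc i - 1) (j - 1 + 1) \<ge> r (Suc i - 1) (j - 1) + r (Suc i) (j - 1 + 1)"
      using rank_conditions unfolding rank_conditions_def by blast
    moreover have "j - 1 + 1 = j" "Suc i - 1 = i" using that by auto
    ultimately show ?thesis by simp
  qed
  consider "j \<le> i" | "j = Suc i" | "Suc i < j" by linarith
  then have "R i j \<le> R (Suc i) j \<and> R i j \<le> R i (j - 1) \<and>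
    R (Suc i) j + R i (j - 1) \<le> R (Suc i) (j - 1) + R i j"
  proof cases
    case 1
    then show ?thesis
      using assms R_low_Suc_left[of j i] R_low_Suc_left[of "j - 1" i] R_low_pred_right[of j i] by auto
  next
    case 2
    have "R i j = r i j" using 2 assms by (simp add: rank_ext_def)
    moreover have "R (Suc i) j = r (Suc i) j" "R i (j - 1) = r i i"
      using 2 assms by (simp_all add: rank_ext_def dim_vec_def)
    moreover have "R (Suc i) (j - 1) = r i i + r (Suc i) j"
      using 2 assms R_low_Suc_left[of i i] by (simp add: rank_ext_def dim_vec_def)
    ultimately show ?thesis using mono 2 by auto
  next
    case 3
    then have "R i j = r i j" "R i (j - 1) = r i (j - 1)" "R (Suc i) j = r (Suc i) j"
      using assms by (auto simp: rank_ext_def)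
    moreover have "R (Suc i) (j - 1) = r (Suc i) (j - 1)"
      using 3 assms by (cases "j - 1 = Suc i") (auto simp: rank_ext_def dim_vec_def)
    ultimately show ?thesis using mono rect 3 by auto
  qed
  then show "R i j \<le> R (Suc i) j" "R i j \<le> R i (j - 1)"
    "R (Suc i) j + R i (j - 1) \<le> R (Suc i) (j - 1) + R i j" by auto
qed

lemma R_mono_left:
  assumes "i \<le> k" "k \<le> n" "j \<le> n"
  shows "R i j \<le> R k j"
  using assms
proof (induction k rule: dec_induct)
  case (step k)
  then have "R k j \<le> R (Suc k) j"
    using R_le_Suc_left[of k j] R_low_Suc_left[of j k] by (cases "j = 0") auto
  with step show ?case by simp
qed simp

lemma R_0_right: "k \<le> n \<Longrightarrow> R k 0 \<le> N"
  unfolding rank_ext_def total_dim_def by (auto intro!: sum_mono2)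

lemma R_n_le: "R n k \<le> N"
  unfolding rank_ext_def total_dim_def by (auto intro!: sum_mono2)

lemma R_n_0: "R n 0 = N"
  by (simp add: rank_ext_def total_dim_def)

section \<open>The factors \<open>W_perm\<close>\<close>

lemma W_perm_permutes:
  assumes "i < n" "1 \<le> j" "j \<le> n"
  shows "W_perm n r i j permutes {1..R (Suc i) (j - 1)}"
proof -
  define d s t u where "d = R i j" and "s = R (Suc i) j" and "t = R i (j - 1)"
    and "u = R (Suc i) (j - 1)"
  have le: "d \<le> s" "d \<le> t" "s + t \<le> u + d"
    using R_rect[OF assms] by (simp_all add: d_def s_def t_def u_def)
  have W: "W_perm n r i j p = (if d < p \<and> p \<le> s then p + t - d
      else if s < p \<and> p \<le> s + t - d then p - s + d else p)" for p
    by (simp add: W_perm_def Let_def d_def s_def t_def)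
  have "W_perm n r i j permutes {1..u}"
  proof (rule bij_imp_permutes)
    \<comment> \<open>An exchange of two adjacent blocks is undone by the exchange with
      \<open>s\<close> and \<open>t\<close> interchanged.\<close>
    show "bij_betw (W_perm n r i j) {1..u} {1..u}"
      by (rule bij_betw_byWitness[where f' = "\<lambda>p. if d < p \<and> p \<le> t then p + s - d
        else if t < p \<and> p \<le> s + t - d then p - t + d else p"]) (use le in \<open>auto simp: W\<close>)
    show "W_perm n r i j p = p" if "p \<notin> {1..u}" for p
      using that le by (auto simp: W)
  qed
  then show ?thesis by (simp add: u_def)
qed

lemma W_perm_low [simp]: "p \<le> R i j \<Longrightarrow> i < n \<Longrightarrow> 1 \<le> j \<Longrightarrow> j \<le> n \<Longrightarrow> W_perm n r i j p = p"
  using R_le_Suc_left[of i j] by (simp add: W_perm_def)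

text \<open>For \<open>j \<le> i\<close> the upper block has length \<open>e (j - 1)\<close> and
  therefore ends exactly at \<open>R (Suc i) (j - 1)\<close>.\<close>

lemma W_perm_shift_down:
  assumes "j \<le> i" "i < n" "1 \<le> j" "R (Suc i) j < p" "p \<le> R (Suc i) (j - 1)"
  shows "W_perm n r i j p = p - R (Suc i) j + R i j"
  using assms R_low_pred_right[of j i] R_low_pred_right[of j "Suc i"] by (simp add: W_perm_def Let_def)

lemma W_perm_shift_up:
  assumes "j \<le> i" "i < n" "1 \<le> j" "R i j < p" "p \<le> R (Suc i) j"
  shows "W_perm n r i j p = p + e (j - 1)"
  using assms R_low_pred_right[of j i] by (simp add: W_perm_def Let_def)

lemma column_perm_permutes:
  assumes "m \<le> n" "1 \<le> j" "j \<le> n"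
  shows "column_perm n r j m permutes {1..R m (j - 1)}"
  using assms
proof (induction m)
  case (Suc m)
  have "column_perm n r j m permutes {1..R m (j - 1)}"
    using Suc by simp
  moreover have "{1..R m (j - 1)} \<subseteq> {1..R (Suc m) (j - 1)}"
    using R_mono_left[of m "Suc m" "j - 1"] Suc by auto
  ultimately show ?case
    using W_perm_permutes[of m j] Suc unfolding column_perm_Suc
    by (intro permutes_compose) (auto elim: permutes_subset)
qed (simp add: permutes_id)

lemma columns_perm_permutes: "m \<le> n \<Longrightarrow> columns_perm n r m permutes {1..N}"
proof (induction m)
  case (Suc m)
  have "column_perm n r (Suc m) n permutes {1..R n m}"
    using column_perm_permutes[of n "Suc m"] Suc by simp
  moreover have "R n m \<le> N" by (rule R_n_le)
  ultimately have "column_perm n r (Suc m) n permutes {1..N}"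
    by (auto elim: permutes_subset)
  then show ?case
    unfolding columns_perm_Suc using Suc by (intro permutes_compose) simp_all
qed (simp add: permutes_id)

lemma z_perm_permutes: "z_perm n r permutes {1..N}"
  unfolding z_perm_eq_columns_perm by (rule columns_perm_permutes) simp

section \<open>The way of a position through the columns\<close>

lemma column_perm_low:
  assumes "k \<le> m" "m \<le> n" "1 \<le> j" "j \<le> n" "p \<le> R k j"
  shows "column_perm n r j m p = column_perm n r j k p"
  using assms
proof (induction m rule: dec_induct)
  case (step m)
  \<comment> \<open>\<open>W_perm n r m j\<close> fixes everything up to \<open>R m j\<close>, and
    these bounds grow with \<open>m\<close>.\<close>
  have "p \<le> R m j" using step R_mono_left[of k m j] by simp
  with step show ?case by simp
qed simp

text \<open>By \<open>column_perm_low\<close> only the factors with index below \<open>k\<close> act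
  on \<open>p\<close> in the rightmost column, and they preserve \<open>{1..R k j}\<close>; thus
  each column relaxes the bound from \<open>R k (Suc j)\<close> to \<open>R k j\<close>.\<close>

lemma columns_perm_low:
  assumes "k \<le> n" "j \<le> n" "1 \<le> p" "p \<le> R k j"
  shows "columns_perm n r j p \<le> R k 0"
  using assms
proof (induction j arbitrary: p)
  case (Suc j)
  let ?q = "column_perm n r (Suc j) n p"
  have q: "?q = column_perm n r (Suc j) k p"
    using Suc column_perm_low[of k n "Suc j" p] by simp
  have per: "column_perm n r (Suc j) k permutes {1..R k j}"
    using column_perm_permutes[of k "Suc j"] Suc by simp
  have "p \<le> R k j \<or> (column_perm n r (Suc j) k p = p)"
    using permutes_not_in[OF per] by auto
  moreover have "R k (Suc j) \<le> R k j"
  proof (cases "k < n")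
    case True
    then show ?thesis using R_le_pred_right[of k "Suc j"] Suc by simp
  next
    case False
    then show ?thesis using Suc R_low_pred_right[of "Suc j" k] by simp
  qed
  ultimately have "p \<in> {1..R k j}" using Suc by auto
  then have "?q \<in> {1..R k j}" using permutes_in_image[OF per] q by simp
  then show ?case using Suc.IH[of ?q] Suc.prems by simp
qed simp

text \<open>For \<open>j \<le> i < m\<close> the factor \<open>W_perm n r i j\<close> lowers the
  position by \<open>e (Suc i)\<close>, which preserves its offset within the upper block; the total
  shift is \<open>R m j - R j j\<close>.\<close>

lemma column_perm_shift_down:
  assumes "j \<le> m" "m \<le> n" "1 \<le> j" "R m j < p" "p \<le> R m (j - 1)"
  shows "column_perm n r j m p = column_perm n r j j (p - R m j + R j j)"
  using assms
proof (induction m arbitrary: p rule: dec_induct)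
  case (step m)
  have W: "W_perm n r m j p = p - R (Suc m) j + R m j"
    using step W_perm_shift_down[of j m p] by simp
  have "p - R (Suc m) j + R m j \<le> R m (j - 1)" "R m j < p - R (Suc m) j + R m j"
    using step R_low_pred_right[of j m] R_low_pred_right[of j "Suc m"] by auto
  then show ?case
    using step W by simp
qed simp

text \<open>Columns beyond \<open>k\<close> move only positions in
  \<open>{1..R n k}\<close>.\<close>

lemma columns_perm_high:
  assumes "k \<le> m" "m \<le> n" "R n k < p"
  shows "columns_perm n r m p = columns_perm n r k p"
  using assms
proof (induction m rule: dec_induct)
  case (step m)
  have "R n m \<le> R n k"
    using step by (auto simp: rank_ext_def intro!: sum_mono2)
  moreover have "column_perm n r (Suc m) n permutes {1..R n m}"
    using column_perm_permutes[of n "Suc m"] step by simp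
  ultimately have "column_perm n r (Suc m) n p = p"
    using step by (auto intro: permutes_not_in)
  with step show ?case by simp
qed simp

lemma z_perm_high:
  assumes "k \<le> n" "R n k < p" "p \<le> N"
  shows "z_perm n r p \<le> R k 0"
  using assms
proof (induction k)
  case 0
  then show ?case by (simp add: R_n_0)
next
  case (Suc k)
  show ?case
  proof (cases "R n k < p")
    case True
    then have "z_perm n r p \<le> R k 0" using Suc by simp
    also have "\<dots> \<le> R (Suc k) 0" using Suc by (intro R_mono_left) auto
    finally show ?thesis .
  next
    \<comment> \<open>The positions that are new for \<open>Suc k\<close> form the upper block of
      column \<open>Suc k\<close>. That column sends them into \<open>{1..R (Suc k) k}\<close>, and
      the remaining columns keep the image at most \<open>R (Suc k) 0\<close>.\<close>
    case False
    have per: "column_perm n r (Suc k) (Suc k) permutes {1..R (Suc k) k}"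
      using column_perm_permutes[of "Suc k" "Suc k"] Suc by simp
    have "p - R n (Suc k) + R (Suc k) (Suc k) \<in> {1..R (Suc k) k}"
      using False Suc R_low_pred_right[of "Suc k" n] R_low_pred_right[of "Suc k" "Suc k"] by auto
    then have "column_perm n r (Suc k) n p \<in> {1..R (Suc k) k}"
      using column_perm_shift_down[of "Suc k" n p] Suc.prems False permutes_in_image[OF per] by auto
    then have "columns_perm n r k (column_perm n r (Suc k) n p) \<le> R (Suc k) 0"
      using Suc.prems by (intro columns_perm_low) auto
    moreover have "z_perm n r p = columns_perm n r (Suc k) p"
      using Suc.prems by (simp add: z_perm_eq_columns_perm columns_perm_high del: columns_perm_Suc)
    ultimately show ?thesis by simp
  qed
qed

text \<open>The position runs through \<open>R (Suc i) j\<close>, \<open>R (Suc i) (j - 1)\<close>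
  and so on to \<open>R (Suc i) 0\<close>: in each column only the factor with index
  \<open>i\<close> moves it, to the top of the next interval. The strict inequality due to
  \<open>1 \<le> e (Suc i)\<close> puts it out of reach of the factors with smaller index.\<close>

lemma columns_perm_R_Suc:
  assumes "i < n" "1 \<le> e (Suc i)" "j \<le> i"
  shows "columns_perm n r j (R (Suc i) j) = R (Suc i) 0"
  using assms(3)
proof (induction j)
  case (Suc j)
  have lt: "R i l < R (Suc i) l" if "l \<le> i" for l
    using R_low_Suc_left[of l i] that assms by simp
  have "column_perm n r (Suc j) n (R (Suc i) (Suc j)) =
      column_perm n r (Suc j) (Suc i) (R (Suc i) (Suc j))"
    using Suc assms by (intro column_perm_low) auto
  also have "\<dots> = column_perm n r (Suc j) i (R (Suc i) (Suc j) + e j)"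
    using Suc assms W_perm_shift_up[of "Suc j" i] lt[of "Suc j"] by simp
  also have "R (Suc i) (Suc j) + e j = R (Suc i) j"
    using R_low_pred_right[of "Suc j" "Suc i"] Suc assms by simp
  also have "column_perm n r (Suc j) i (R (Suc i) j) = R (Suc i) j"
  proof (rule permutes_not_in)
    show "column_perm n r (Suc j) i permutes {1..R i j}"
      using column_perm_permutes[of i "Suc j"] Suc assms by simp
    show "R (Suc i) j \<notin> {1..R i j}" using lt[of j] Suc by auto
  qed
  finally show ?case using Suc by simp
qed simp

text \<open>Because of \<open>1 \<le> r i (Suc i)\<close> the blocks exchanged by
  \<open>W_perm n r i (Suc i)\<close> end before \<open>R (Suc i) i\<close>. The position therefore
  stays at the end of its interval, where \<open>columns_perm_R_Suc\<close> takes over.\<close>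

lemma z_perm_corner:
  assumes "i < n" "1 \<le> e i" "1 \<le> e (Suc i)" "1 \<le> r i (Suc i)"
  shows "z_perm n r (R n i) = R (Suc i) 0"
proof -
  have Rn: "R n i = R n (Suc i) + e i"
    using assms R_low_pred_right[of "Suc i" n] by simp
  have RS: "R (Suc i) i = R (Suc i) (Suc i) + e i" "R i i = e i" "R (Suc i) (Suc i) = e (Suc i)"
    using assms R_low_pred_right[of "Suc i" "Suc i"] by (simp_all add: R_diag)
  have "column_perm n r (Suc i) n (R n i) =
      column_perm n r (Suc i) (Suc i) (R n i - R n (Suc i) + R (Suc i) (Suc i))"
    using Rn assms by (intro column_perm_shift_down) auto
  also have "R n i - R n (Suc i) + R (Suc i) (Suc i) = R (Suc i) i"
    using Rn RS by simp
  also have "column_perm n r (Suc i) (Suc i) (R (Suc i) i) = column_perm n r (Suc i) i (R (Suc i) i)"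
  proof -
    have "R i (Suc i) = r i (Suc i)" using assms by (simp add: rank_ext_def)
    moreover have "\<not> R (Suc i) i \<le> e (Suc i) + e i - r i (Suc i)" using assms RS by arith
    ultimately have "W_perm n r i (Suc i) (R (Suc i) i) = R (Suc i) i"
      using assms RS by (simp add: W_perm_def Let_def)
    then show ?thesis by simp
  qed
  also have "\<dots> = R (Suc i) i"
  proof (rule permutes_not_in)
    show "column_perm n r (Suc i) i permutes {1..R i i}"
      using column_perm_permutes[of i "Suc i"] assms by simp
    show "R (Suc i) i \<notin> {1..R i i}" using RS assms by auto
  qed
  finally have "columns_perm n r (Suc i) (R n i) = R (Suc i) 0"
    using columns_perm_R_Suc[of i i] assms by simp
  moreover have "z_perm n r (R n i) = columns_perm n r (Suc i) (R n i)"
    using assms Rn by (simp add: z_perm_eq_columns_perm columns_perm_high del: columns_perm_Suc)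
  ultimately show ?thesis by simp
qed

section \<open>Values of \<open>zhat_perm\<close> up to the corner\<close>

lemma zhat_perm_permutes: "zhat_perm n r permutes {1..N}"
  unfolding zhat_perm_def
  by (intro permutes_compose longest_perm_permutes permutes_inv z_perm_permutes)

text \<open>Contraposition of \<open>z_perm_high\<close>, carried through the inverse and the two
  reversals: the preimage of a value above \<open>R k 0\<close> is at most
  \<open>R n k\<close>.\<close>

lemma zhat_perm_gt:
  assumes "k \<le> n" "1 \<le> q" "q \<le> N - R k 0"
  shows "N - R n k < zhat_perm n r q"
proof -
  have "R k 0 \<le> N" using assms(1) by (rule R_0_right)
  define P where "P = N + 1 - q"
  define Q where "Q = inv (z_perm n r) P"
  have P: "P \<in> {1..N}" "R k 0 < P" using assms \<open>R k 0 \<le> N\<close> by (auto simp: P_def)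
  have Q: "Q \<in> {1..N}" "z_perm n r Q = P"
    using P permutes_in_image[OF permutes_inv[OF z_perm_permutes]] permutes_inverses[OF z_perm_permutes]
    by (simp_all add: Q_def)
  then have "Q \<le> R n k"
    using z_perm_high[of k Q] P assms by fastforce
  moreover have "zhat_perm n r q = N + 1 - Q"
    using assms Q(1) by (auto simp: zhat_perm_def longest_perm_def Q_def P_def)
  ultimately show ?thesis using Q by auto
qed

lemma zhat_perm_corner:
  assumes "i < n" "1 \<le> e i" "1 \<le> e (Suc i)" "1 \<le> r i (Suc i)"
  shows "zhat_perm n r (N + 1 - R (Suc i) 0) = N + 1 - R n i"
proof -
  have "R (Suc i) 0 \<le> N" using assms by (intro R_0_right) auto
  moreover have "1 \<le> R (Suc i) 0" using R_low_Suc_left[of 0 i] assms by simp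
  moreover have "inv (z_perm n r) (R (Suc i) 0) = R n i"
    using z_perm_corner[OF assms] permutes_inverses(2)[OF z_perm_permutes] by metis
  moreover have "1 \<le> R n i"
    using R_low_pred_right[of "Suc i" n] assms by simp
  ultimately show ?thesis
    using R_n_le[of i] by (auto simp: zhat_perm_def longest_perm_def)
qed

text \<open>Both bounds come from \<open>zhat_perm_gt\<close>, with \<open>k = Suc i\<close> before
  the corner and \<open>k = i\<close> at the corner. In the first, \<open>1 \<le> e i\<close>
  improves the bound to the required one; in the second, \<open>1 \<le> e (Suc i)\<close> makes the
  position admissible.\<close>

lemma zhat_perm_ge:
  assumes "i < n" "1 \<le> e i" "1 \<le> e (Suc i)"
  shows "q \<in> {1..<N + 1 - R (Suc i) 0} \<Longrightarrow> N + 1 - R n i < zhat_perm n r q"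
    and "N + 1 - R n i \<le> zhat_perm n r (N + 1 - R (Suc i) 0)"
proof -
  have Rn: "R n i = R n (Suc i) + e i"
    using assms R_low_pred_right[of "Suc i" n] by simp
  with R_n_le[of i] assms(2) have "N + 1 - R n i \<le> N - R n (Suc i)" by simp
  then show "N + 1 - R n i < zhat_perm n r q" if "q \<in> {1..<N + 1 - R (Suc i) 0}"
    using zhat_perm_gt[of "Suc i" q] that assms(1) by fastforce
  have "R (Suc i) 0 \<le> N" using assms by (intro R_0_right) auto
  moreover have "R (Suc i) 0 = R i 0 + e (Suc i)" using R_low_Suc_left[of 0 i] assms by simp
  ultimately have "N - R n i < zhat_perm n r (N + 1 - R (Suc i) 0)"
    using assms by (intro zhat_perm_gt) auto
  then show "N + 1 - R n i \<le> zhat_perm n r (N + 1 - R (Suc i) 0)" by simp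
qed

end

section \<open>Maximal ranks\<close>

lemma dim_vec_max_ranks [simp]: "dim_vec (max_ranks e) = e"
  by (rule ext) (simp add: dim_vec_def max_ranks_def)

lemma total_dim_max_ranks [simp]: "total_dim n (max_ranks (dim_vec r)) = total_dim n r"
  by (simp add: total_dim_def)

lemma rank_ext_low_max_ranks:
  "j \<le> i \<Longrightarrow> rank_ext n (max_ranks (dim_vec r)) i j = rank_ext n r i j"
  by (simp add: rank_ext_def)

lemma max_ranks_Suc_left: "i < j \<Longrightarrow> max_ranks e i j = min (e i) (max_ranks e (Suc i) j)"
proof -
  assume "i < j"
  then have "{i..j} = insert i {Suc i..j}" by auto
  then show ?thesis using \<open>i < j\<close> by (simp add: max_ranks_def)
qed

lemma max_ranks_Suc_right: "i \<le> j \<Longrightarrow> max_ranks e i (Suc j) = min (e (Suc j)) (max_ranks e i j)"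
proof -
  assume "i \<le> j"
  then have "{i..Suc j} = insert (Suc j) {i..j}" by auto
  then show ?thesis using \<open>i \<le> j\<close> by (simp add: max_ranks_def)
qed

text \<open>This makes the locale \<open>ranks\<close> available for the denominator. With
  \<open>m\<close> the minimum over \<open>i..j\<close> and \<open>p\<close>, \<open>q\<close> the
  two adjacent dimensions, the second condition is
  \<open>m + min q (min p m) \<ge> min p m + min q m\<close>.\<close>

lemma rank_conditions_max_ranks: "1 \<le> n \<Longrightarrow> rank_conditions n (max_ranks e)"
  unfolding rank_conditions_def
proof (intro conjI allI impI)
  fix i j :: nat
  assume "i < j \<and> j \<le> n"
  then have "max_ranks e i j \<le> max_ranks e (Suc i) j" "max_ranks e i j \<le> max_ranks e i (j - 1)"
    using max_ranks_Suc_left[of i j e] max_ranks_Suc_right[of i "j - 1" e]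
    by (metis min.cobounded2, metis Suc_pred' gr_implies_not0 less_Suc_eq_le min.cobounded2 neq0_conv)
  then show "max_ranks e i j \<le> min (max_ranks e i (j - 1)) (max_ranks e (i + 1) j)"
    using \<open>i < j \<and> j \<le> n\<close> by simp
next
  fix i j :: nat
  assume ij: "0 < i \<and> i \<le> j \<and> j < n"
  then have "i - 1 < j" "i - 1 \<le> j" "i \<le> j" "Suc (i - 1) = i" by auto
  then have "max_ranks e (i - 1) (Suc j) = min (e (Suc j)) (min (e (i - 1)) (max_ranks e i j))"
    "max_ranks e (i - 1) j = min (e (i - 1)) (max_ranks e i j)"
    "max_ranks e i (Suc j) = min (e (Suc j)) (max_ranks e i j)"
    using max_ranks_Suc_left[of "i - 1" j e] max_ranks_Suc_right[of i j e]
      max_ranks_Suc_right[of "i - 1" j e] by simp_all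
  then show "max_ranks e (i - 1) j + max_ranks e i (j + 1)
      \<le> max_ranks e i j + max_ranks e (i - 1) (j + 1)"
    by (simp add: min_def)
qed simp

section \<open>Grothendieck polynomials as functions\<close>

text \<open>
  A word of ascents leading from \<open>w\<close> up to the longest element. Along such a word the recursion
  can be evaluated at points of an arbitrary field, as long as the \<open>a\<^sub>p\<close> are distinct; this turns
  substitutions into changes of the point.
\<close>

inductive ascent_word :: "nat \<Rightarrow> nat list \<Rightarrow> (nat \<Rightarrow> nat) \<Rightarrow> bool" for N :: nat where
  Nil: "ascent_word N [] (longest_perm N)"
| Cons: "ascent_word N is (w \<circ> transpose i (Suc i)) \<Longrightarrow> w permutes {1..N} \<Longrightarrow> 1 \<le> i \<Longrightarrow> i < N \<Longrightarrow>
    w i < w (Suc i) \<Longrightarrow> ascent_word N (i # is) w"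

fun groth_eval :: "nat \<Rightarrow> nat list \<Rightarrow> (nat \<Rightarrow> 'k::field) \<Rightarrow> (nat \<Rightarrow> 'k) \<Rightarrow> 'k" where
  "groth_eval N [] a b = (\<Prod>(p, q)\<in>{(p, q). 1 \<le> p \<and> 1 \<le> q \<and> p + q \<le> N}. 1 - b p / a q)"
| "groth_eval N (i # is) a b =
    (a i * groth_eval N is a b - a (Suc i) * groth_eval N is (a \<circ> transpose i (Suc i)) b) /
    (a i - a (Suc i))"

lemma ascent_word_permutes: "ascent_word N is w \<Longrightarrow> w permutes {1..N}"
  by (induction rule: ascent_word.induct) (simp_all only: longest_perm_permutes)

lemma ascent_word_letters: "ascent_word N is w \<Longrightarrow> set is \<subseteq> {1..<N}"
  by (induction rule: ascent_word.induct) auto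

lemma transpose_permutes: "1 \<le> i \<Longrightarrow> i < N \<Longrightarrow> transpose i (Suc i) permutes {1..N}"
  by (rule permutes_swap_id) auto

lemma inj_on_comp_transpose:
  assumes "inj_on a {1..N}" "1 \<le> i" "i < N"
  shows "inj_on (a \<circ> transpose i (Suc i)) {1..N}"
  using assms permutes_image[OF transpose_permutes] by (intro comp_inj_on) auto

text \<open>A strictly decreasing sequence of \<open>N\<close> values in \<open>{1..N}\<close> has
  no freedom: descending from position \<open>N\<close> gives the lower bound, ascending from
  position \<open>1\<close> the upper one.\<close>

lemma eq_longest_perm:
  assumes "w permutes {1..N}" "\<And>i. 1 \<le> i \<Longrightarrow> i < N \<Longrightarrow> w (Suc i) < w i"
  shows "w = longest_perm N"
proof
  fix p
  have *: "w q \<in> {1..N}" if "q \<in> {1..N}" for q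
    using permutes_in_image[OF assms(1)] that by simp
  have "N + 1 - p = w p" if "1 \<le> p" "p \<le> N"
  proof (rule antisym)
    show "N + 1 - p \<le> w p" using that(2,1)
    proof (induction p rule: inc_induct)
      case base
      then show ?case using *[of N] by auto
    next
      case (step m)
      then show ?case using assms(2)[of m] by simp
    qed
    show "w p \<le> N + 1 - p" using that
    proof (induction p rule: dec_induct)
      case base
      then show ?case using *[of 1] by auto
    next
      case (step m)
      then show ?case using assms(2)[of m] by simp
    qed
  qed
  then show "w p = longest_perm N p"
    using permutes_not_in[OF assms(1)] by (auto simp: longest_perm_def)
qed

text \<open>Instead of the number of inversions, this sum serves as the induction measure.\<close>

lemma weighted_sum_less:
  assumes "1 \<le> i" "i < N" "w i < w (Suc i)"
  shows "(\<Sum>p\<in>{1..N}. p * (w \<circ> transpose i (Suc i)) p) < (\<Sum>p\<in>{1..N}. p * (w p :: nat))"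
proof -
  define S where "S = {1..N} - {i, Suc i}"
  have S: "{1..N} = insert i (insert (Suc i) S)" "i \<notin> S" "Suc i \<notin> S" "finite S"
    using assms by (auto simp: S_def)
  obtain d where d: "w (Suc i) = w i + Suc d"
    using assms(3) less_iff_Suc_add by auto
  have "(\<Sum>p\<in>S. p * (w \<circ> transpose i (Suc i)) p) = (\<Sum>p\<in>S. p * w p)"
    using S by (intro sum.cong) (auto simp: transpose_def)
  then show ?thesis
    unfolding S(1) using S(2-) d by (simp add: algebra_simps)
qed

lemma ascent_word_exists:
  assumes "w permutes {1..N}"
  obtains "is" where "ascent_word N is w"
proof -
  have "\<exists>is. ascent_word N is w"
    using assms
  proof (induction "\<Sum>p\<in>{1..N}. p * w p" arbitrary: w rule: less_induct)
    case less
    show ?case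
    proof (cases "\<exists>i. 1 \<le> i \<and> i < N \<and> w i < w (Suc i)")
      case True
      then obtain i where i: "1 \<le> i" "i < N" "w i < w (Suc i)" by blast
      have "w \<circ> transpose i (Suc i) permutes {1..N}"
        using less(2) transpose_permutes i by (intro permutes_compose) auto
      then obtain "is" where "ascent_word N is (w \<circ> transpose i (Suc i))"
        using less(1) weighted_sum_less[of i N w] i by blast
      then show ?thesis using i less(2) ascent_word.Cons by blast
    next
      case False
      have "w (Suc i) < w i" if "1 \<le> i" "i < N" for i
      proof -
        have "w (Suc i) \<noteq> w i"
          using permutes_inj[OF less(2)] by (metis injD n_not_Suc_n)
        with False that show ?thesis by (meson linorder_neqE_nat)
      qed
      then have "w = longest_perm N" using less(2) by (intro eq_longest_perm) auto
      then show ?thesis using ascent_word.Nil by blast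
    qed
  qed
  then show ?thesis using that by blast
qed

lemma longest_perm_no_ascent: "1 \<le> i \<Longrightarrow> i < N \<Longrightarrow> \<not> longest_perm N i < longest_perm N (Suc i)"
  by (simp add: longest_perm_def)

section \<open>Commutation and braid relations of the isobaric divided differences\<close>

lemma isobaric_commute:
  fixes a :: "nat \<Rightarrow> 'k::field"
  assumes "Suc i < j" "a i \<noteq> a (Suc i)" "a j \<noteq> a (Suc j)"
  shows "groth_eval N (i # j # is) a b = groth_eval N (j # i # is) a b"
proof -
  define u where "u = groth_eval N is a b"
  define v where "v = groth_eval N is (a \<circ> transpose i (Suc i)) b"
  define v' where "v' = groth_eval N is (a \<circ> transpose j (Suc j)) b"
  define t where "t = groth_eval N is (a \<circ> transpose i (Suc i) \<circ> transpose j (Suc j)) b"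
  have comm: "a \<circ> transpose j (Suc j) \<circ> transpose i (Suc i) = a \<circ> transpose i (Suc i) \<circ> transpose j (Suc j)"
    using assms(1) by (auto simp: fun_eq_iff transpose_def)
  have "(a \<circ> transpose i (Suc i)) j = a j" "(a \<circ> transpose i (Suc i)) (Suc j) = a (Suc j)"
      "(a \<circ> transpose j (Suc j)) i = a i" "(a \<circ> transpose j (Suc j)) (Suc i) = a (Suc i)"
    using assms(1) by (auto simp: transpose_def)
  note vals = this
  have ne: "a i - a (Suc i) \<noteq> 0" "a j - a (Suc j) \<noteq> 0" using assms(2,3) by auto
  show ?thesis
    by (simp only: groth_eval.simps vals comm u_def[symmetric] v_def[symmetric] v'_def[symmetric] t_def[symmetric])
      (use ne in \<open>simp add: divide_simps\<close>, simp add: algebra_simps)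
qed

text \<open>Both sides are the operator of the longest element on three letters: the signed sum
  \<open>E\<close> of the six rearrangements of \<open>x\<^sup>2 * y\<close> times the inner value,
  divided by the Vandermonde product \<open>V\<close>.\<close>

lemma isobaric_braid:
  fixes a :: "nat \<Rightarrow> 'k::field"
  assumes "a i \<noteq> a (Suc i)" "a i \<noteq> a (Suc (Suc i))" "a (Suc i) \<noteq> a (Suc (Suc i))"
  shows "groth_eval N (i # Suc i # i # is) a b = groth_eval N (Suc i # i # Suc i # is) a b"
proof -
  let ?s = "transpose i (Suc i)" and ?t = "transpose (Suc i) (Suc (Suc i))"
  define x y z where "x = a i" and "y = a (Suc i)" and "z = a (Suc (Suc i))"
  define u1 u2 u3 u4 u5 u6 where "u1 = groth_eval N is a b" and "u2 = groth_eval N is (a \<circ> ?s) b"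
    and "u3 = groth_eval N is (a \<circ> ?t) b" and "u4 = groth_eval N is (a \<circ> ?s \<circ> ?t) b"
    and "u5 = groth_eval N is (a \<circ> ?t \<circ> ?s) b" and "u6 = groth_eval N is (a \<circ> ?s \<circ> ?t \<circ> ?s) b"
  have braid: "a \<circ> ?t \<circ> ?s \<circ> ?t = a \<circ> ?s \<circ> ?t \<circ> ?s" and invol: "a \<circ> ?s \<circ> ?s = a" "a \<circ> ?t \<circ> ?t = a"
    by (auto simp: fun_eq_iff transpose_def)
  have "(a \<circ> ?s) i = y" "(a \<circ> ?s) (Suc i) = x" "(a \<circ> ?s) (Suc (Suc i)) = z"
    "(a \<circ> ?t) i = x" "(a \<circ> ?t) (Suc i) = z" "(a \<circ> ?t) (Suc (Suc i)) = y"
    "(a \<circ> ?s \<circ> ?t) i = y" "(a \<circ> ?s \<circ> ?t) (Suc i) = z" "(a \<circ> ?s \<circ> ?t) (Suc (Suc i)) = x"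
    "(a \<circ> ?t \<circ> ?s) i = z" "(a \<circ> ?t \<circ> ?s) (Suc i) = x" "(a \<circ> ?t \<circ> ?s) (Suc (Suc i)) = y"
    by (auto simp: transpose_def x_def y_def z_def)
  note vals = this
  have ne: "x - y \<noteq> 0" "x - z \<noteq> 0" "y - z \<noteq> 0" "y - x \<noteq> 0" "z - x \<noteq> 0" "z - y \<noteq> 0"
    using assms by (auto simp: x_def y_def z_def)
  define V where "V = (x - y) * (x - z) * (y - z)"
  define E where "E = x\<^sup>2 * y * u1 - y\<^sup>2 * x * u2 - x\<^sup>2 * z * u3 + y\<^sup>2 * z * u4 + z\<^sup>2 * x * u5 - z\<^sup>2 * y * u6"
  have "groth_eval N (i # Suc i # i # is) a b = E / V"
    by (simp only: groth_eval.simps vals braid invol x_def[symmetric] y_def[symmetric] z_def[symmetric]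
       u1_def[symmetric] u2_def[symmetric] u3_def[symmetric] u4_def[symmetric] u5_def[symmetric] u6_def[symmetric])
      (use ne in \<open>simp add: E_def V_def divide_simps\<close>, simp add: algebra_simps power2_eq_square)
  moreover have "groth_eval N (Suc i # i # Suc i # is) a b = E / V"
    by (simp only: groth_eval.simps vals braid invol x_def[symmetric] y_def[symmetric] z_def[symmetric]
       u1_def[symmetric] u2_def[symmetric] u3_def[symmetric] u4_def[symmetric] u5_def[symmetric] u6_def[symmetric])
      (use ne in \<open>simp add: E_def V_def divide_simps\<close>, simp add: algebra_simps power2_eq_square)
  ultimately show ?thesis by simp
qed

text \<open>A diamond argument: words starting with different ascents \<open>i\<close> and
  \<open>j\<close> are replaced, by induction, by words that reach a common permutation after two or
  three letters, and there the commutation or braid relation applies. The point \<open>a\<close>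
  varies in the induction because the recursion rearranges it.\<close>

lemma groth_eval_word_unique:
  assumes "ascent_word N is w" "ascent_word N js w" "inj_on a {1..N}"
  shows "groth_eval N is a b = groth_eval N js a b"
  using assms
proof (induction "\<Sum>p\<in>{1..N}. p * w p" arbitrary: "is" js w a rule: less_induct)
  case less
  have IH: "groth_eval N is a b = groth_eval N js a b"
    if "ascent_word N is (w \<circ> transpose i (Suc i))" "ascent_word N js (w \<circ> transpose i (Suc i))"
      "1 \<le> i" "i < N" "w i < w (Suc i)" "inj_on a {1..N}" for "is" js i and a :: "nat \<Rightarrow> 'a"
    using less(1)[OF weighted_sum_less[OF that(3-5)] that(1,2,6)] .
  have neq: "a p \<noteq> a q" if "p \<in> {1..N}" "q \<in> {1..N}" "p \<noteq> q" for p q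
    using less(4) that by (auto dest: inj_onD)
  have eq: "groth_eval N (i # is) a b = groth_eval N (j # js) a b"
    if i: "ascent_word N is (w \<circ> transpose i (Suc i))" "1 \<le> i" "i < N" "w i < w (Suc i)"
      and j: "ascent_word N js (w \<circ> transpose j (Suc j))" "1 \<le> j" "j < N" "w j < w (Suc j)"
      and "i < j" for i j "is" js
  proof -
    let ?s = "transpose i (Suc i)" and ?t = "transpose j (Suc j)"
    have per: "w permutes {1..N}" using less(2) by (rule ascent_word_permutes)
    have s: "?s permutes {1..N}" and t: "?t permutes {1..N}"
      using i j by (simp_all only: transpose_permutes)
    have inj: "inj_on (a \<circ> ?s) {1..N}" "inj_on (a \<circ> ?t) {1..N}"
      using less(4) i j by (simp_all only: inj_on_comp_transpose)
    show ?thesis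
    proof (cases "j = Suc i")
      case False
      with \<open>i < j\<close> have far: "Suc i < j" by simp
      then have comm: "w \<circ> ?t \<circ> ?s = w \<circ> ?s \<circ> ?t"
        by (auto simp: fun_eq_iff transpose_def)
      obtain ks where ks: "ascent_word N ks (w \<circ> ?s \<circ> ?t)"
        using ascent_word_exists[OF permutes_compose[OF t permutes_compose[OF s per]]] by blast
      have "ascent_word N (j # ks) (w \<circ> ?s)" "ascent_word N (i # ks) (w \<circ> ?t)"
        using ks i j far per s t comm
        by (auto intro!: ascent_word.Cons permutes_compose[OF s per] permutes_compose[OF t per])
      then have "groth_eval N (i # is) a b = groth_eval N (i # j # ks) a b"
          "groth_eval N (j # js) a b = groth_eval N (j # i # ks) a b"
        using IH[OF i(1) _ i(2-4)] IH[OF j(1) _ j(2-4)] less(4) inj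
        by (simp_all only: groth_eval.simps(2)[of _ i] groth_eval.simps(2)[of _ j])
      moreover have "a i \<noteq> a (Suc i)" "a j \<noteq> a (Suc j)" using neq i j by simp_all
      note isobaric_commute[OF far this, of N ks b]
      ultimately show ?thesis by (simp only:)
    next
      case True
      have comm: "w \<circ> ?t \<circ> ?s \<circ> ?t = w \<circ> ?s \<circ> ?t \<circ> ?s"
        using True by (auto simp: fun_eq_iff transpose_def)
      obtain ks where ks: "ascent_word N ks (w \<circ> ?s \<circ> ?t \<circ> ?s)"
        using ascent_word_exists[OF permutes_compose[OF s permutes_compose[OF t permutes_compose[OF s per]]]] by blast
      have "ascent_word N (j # i # ks) (w \<circ> ?s)"
        using ks i j True
        by (intro ascent_word.Cons permutes_compose[OF s per]
            permutes_compose[OF t permutes_compose[OF s per]]) (auto simp: transpose_def)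
      moreover have "ascent_word N (i # j # ks) (w \<circ> ?t)"
        using ks[folded comm] i j True
        by (intro ascent_word.Cons permutes_compose[OF t per]
            permutes_compose[OF s permutes_compose[OF t per]]) (auto simp: transpose_def)
      ultimately have "groth_eval N (i # is) a b = groth_eval N (i # j # i # ks) a b"
          "groth_eval N (j # js) a b = groth_eval N (j # i # j # ks) a b"
        using IH[OF i(1) _ i(2-4)] IH[OF j(1) _ j(2-4)] less(4) inj
        by (simp_all only: groth_eval.simps(2)[of _ i] groth_eval.simps(2)[of _ j])
      moreover have "a i \<noteq> a (Suc i)" "a i \<noteq> a (Suc (Suc i))" "a (Suc i) \<noteq> a (Suc (Suc i))"
        using neq i j True by simp_all
      note isobaric_braid[OF this, of N ks b, folded True]
      ultimately show ?thesis by (simp only:)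
    qed
  qed
  show ?case
    using less(2)
  proof cases
    case Nil
    from less(3) have "js = []"
      by cases (use Nil longest_perm_no_ascent in auto)
    then show ?thesis using Nil by simp
  next
    case i: (Cons is' i)
    from less(3) show ?thesis
    proof cases
      case Nil
      then show ?thesis using i longest_perm_no_ascent by auto
    next
      case j: (Cons js' j)
      consider "i = j" | "i < j" | "j < i" by linarith
      then show ?thesis
      proof cases
        case 1
        have "groth_eval N is' a b = groth_eval N js' a b"
            "groth_eval N is' (a \<circ> transpose i (Suc i)) b = groth_eval N js' (a \<circ> transpose i (Suc i)) b"
          using IH[of is' i js'] i j 1 less(4) inj_on_comp_transpose by blast+
        then show ?thesis using i j 1 by simp
      next
        case 2
        then show ?thesis using eq[of is' i js' j] i j by simp
      next
        case 3
        then show ?thesis using eq[of js' j is' i] i j by simp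
      qed
    qed
  qed
qed

section \<open>Compatibility of evaluation with substitution\<close>

lemma ratfun_subst_groth_eval:
  fixes f :: "'v::linorder \<Rightarrow> 'k::field"
  assumes "set is \<subseteq> {1..<N}"
    and "\<And>p. p \<in> {1..N} \<Longrightarrow> ratfun_subst_defined f (a p) \<and> ratfun_subst f (a p) \<noteq> 0"
    and "\<And>p. p \<in> {1..N} \<Longrightarrow> ratfun_subst_defined f (b p)"
    and "inj_on (\<lambda>p. ratfun_subst f (a p)) {1..N}"
  shows "ratfun_subst_defined f (groth_eval N is a b) \<and> ratfun_subst f (groth_eval N is a b) =
    groth_eval N is (\<lambda>p. ratfun_subst f (a p)) (\<lambda>p. ratfun_subst f (b p))"
  using assms
proof (induction "is" arbitrary: a)
  case Nil
  let ?T = "{(p, q). 1 \<le> p \<and> 1 \<le> q \<and> p + q \<le> N}"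
  have *: "ratfun_subst_defined f (1 - b (fst x) / a (snd x)) \<and> ratfun_subst f (1 - b (fst x) / a (snd x)) =
      1 - ratfun_subst f (b (fst x)) / ratfun_subst f (a (snd x))" if "x \<in> ?T" for x
    using that Nil ratfun_subst_diff[of f 1 "b (fst x) / a (snd x)"] ratfun_subst_1[of f]
      ratfun_subst_divide[of f "b (fst x)" "a (snd x)"] by auto
  then have "ratfun_subst_defined f (\<Prod>x\<in>?T. 1 - b (fst x) / a (snd x)) \<and>
      ratfun_subst f (\<Prod>x\<in>?T. 1 - b (fst x) / a (snd x)) =
      (\<Prod>x\<in>?T. ratfun_subst f (1 - b (fst x) / a (snd x)))"
    by (intro ratfun_subst_prod) blast
  moreover have "(\<Prod>x\<in>?T. ratfun_subst f (1 - b (fst x) / a (snd x))) =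
      (\<Prod>x\<in>?T. 1 - ratfun_subst f (b (fst x)) / ratfun_subst f (a (snd x)))"
    by (rule prod.cong) (use * in blast)+
  ultimately show ?case
    unfolding groth_eval.simps(1) case_prod_beta by simp
next
  case (Cons i "is")
  let ?s = "transpose i (Suc i)" and ?g = "ratfun_subst f"
  have i: "1 \<le> i" "i < N" using Cons by auto
  have s: "?s p \<in> {1..N}" if "p \<in> {1..N}" for p
    using permutes_in_image[OF transpose_permutes[OF i]] that by simp
  have inj: "inj_on (\<lambda>p. ?g ((a \<circ> ?s) p)) {1..N}"
    using inj_on_comp_transpose[OF Cons.prems(4) i] by (simp add: comp_def)
  have 1: "ratfun_subst_defined f (groth_eval N is a b) \<and> ?g (groth_eval N is a b) =
      groth_eval N is (\<lambda>p. ?g (a p)) (\<lambda>p. ?g (b p))"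
    using Cons.prems by (intro Cons.IH) auto
  have 2: "ratfun_subst_defined f (groth_eval N is (a \<circ> ?s) b) \<and> ?g (groth_eval N is (a \<circ> ?s) b) =
      groth_eval N is ((\<lambda>p. ?g (a p)) \<circ> ?s) (\<lambda>p. ?g (b p))"
    using Cons.IH[of "a \<circ> ?s"] Cons.prems(1-3) inj s by (simp add: comp_def)
  \<comment> \<open>Distinct values at \<open>i\<close> and \<open>Suc i\<close> keep the divisor of
    the recursion nonzero after the substitution.\<close>
  have a: "ratfun_subst_defined f (a i)" "ratfun_subst_defined f (a (Suc i))"
    and ne: "?g (a i) \<noteq> ?g (a (Suc i))"
    using Cons.prems i by (auto dest: inj_onD)
  show ?case
    using 1 2 a ne by (simp add: ratfun_subst_diff ratfun_subst_mult ratfun_subst_divide)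
qed

lemma groth_eval_cong:
  assumes "set is \<subseteq> {1..<N}" "\<And>p. p \<in> {1..N} \<Longrightarrow> a p = a' p" "\<And>p. p \<in> {1..N} \<Longrightarrow> b p = b' p"
  shows "groth_eval N is a b = groth_eval N is a' b'"
  using assms
proof (induction "is" arbitrary: a a')
  case Nil
  then show ?case by (auto intro!: prod.cong)
next
  case (Cons i "is")
  have i: "1 \<le> i" "i < N" using Cons by auto
  have "groth_eval N is (a \<circ> transpose i (Suc i)) b = groth_eval N is (a' \<circ> transpose i (Suc i)) b'"
    using Cons.prems permutes_in_image[OF transpose_permutes[OF i]] by (intro Cons.IH) auto
  moreover have "groth_eval N is a b = groth_eval N is a' b'"
    using Cons.prems by (intro Cons.IH) auto
  ultimately show ?case using Cons.prems(2) i by simp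
qed

lemma independent_of_groth_eval:
  assumes "set is \<subseteq> {1..<N}"
    and "\<And>p. p \<in> {1..N} \<Longrightarrow> independent_of v (a p)" "\<And>p. p \<in> {1..N} \<Longrightarrow> independent_of v (b p)"
  shows "independent_of v (groth_eval N is a b)"
  using assms
proof (induction "is" arbitrary: a)
  case Nil
  then show ?case
    by (auto intro!: independent_of_prod independent_of_diff independent_of_divide independent_of_1)
next
  case (Cons i "is")
  have i: "1 \<le> i" "i < N" using Cons by auto
  have "independent_of v (groth_eval N is (a \<circ> transpose i (Suc i)) b)"
    using Cons.prems permutes_in_image[OF transpose_permutes[OF i]] by (intro Cons.IH) auto
  moreover have "independent_of v (groth_eval N is a b)"
    using Cons.prems by (intro Cons.IH) auto
  ultimately show ?case
    using Cons.prems(2) i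
    by (auto intro!: independent_of_diff independent_of_divide independent_of_mult)
qed

text \<open>\<open>swap_a\<close> is a substitution that only permutes the values of
  \<open>a\<close>, so they stay distinct and nonzero and \<open>ratfun_subst_groth_eval\<close>
  applies.\<close>

lemma swap_a_groth_eval:
  assumes "set is \<subseteq> {1..<N}"
  shows "swap_a i (groth_eval N is (rvar \<circ> VarA) (rvar \<circ> VarB)) =
    groth_eval N is ((rvar \<circ> VarA) \<circ> transpose i (Suc i)) (rvar \<circ> VarB)"
proof -
  let ?f = "\<lambda>v. case v of VarA p \<Rightarrow> rvar (VarA (transpose i (i + 1) p)) | _ \<Rightarrow> rvar v"
  have f: "ratfun_subst ?f (rvar (VarA p)) = rvar (VarA (transpose i (Suc i) p))"
      "ratfun_subst ?f (rvar (VarB p)) = rvar (VarB p)" for p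
    by (simp_all add: ratfun_subst_rvar)
  have "inj_on (\<lambda>p. ratfun_subst ?f ((rvar \<circ> VarA) p)) {1..N}"
    by (auto simp: f inj_on_def transpose_def split: if_splits)
  then have "ratfun_subst ?f (groth_eval N is (rvar \<circ> VarA) (rvar \<circ> VarB)) =
      groth_eval N is (\<lambda>p. ratfun_subst ?f ((rvar \<circ> VarA) p)) (\<lambda>p. ratfun_subst ?f ((rvar \<circ> VarB) p))"
    using assms ratfun_subst_groth_eval[of "is" N ?f "rvar \<circ> VarA" "rvar \<circ> VarB"]
    by (simp add: ratfun_subst_rvar)
  then show ?thesis
    by (simp add: swap_a_def f comp_def)
qed

section \<open>Existence and uniqueness of the Grothendieck family\<close>

lemma grothendieck_family_unique:
  assumes "grothendieck_family N G" "ascent_word N is w"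
  shows "G w = groth_eval N is (rvar \<circ> VarA) (rvar \<circ> VarB)"
  using assms(2)
proof (induction rule: ascent_word.induct)
  case Nil
  then show ?case using assms(1) by (simp add: grothendieck_family_def)
next
  case (Cons "is" w i)
  have "(rvar (VarA i) - rvar (VarA (i + 1))) * G w =
      rvar (VarA i) * G (w \<circ> transpose i (i + 1)) -
      rvar (VarA (i + 1)) * swap_a i (G (w \<circ> transpose i (i + 1)))"
    using assms(1) Cons unfolding grothendieck_family_def by auto
  moreover have "rvar (VarA i) - rvar (VarA (Suc i)) \<noteq> (0 :: nat var ratfun)"
    by simp
  ultimately show ?case
    using Cons.IH swap_a_groth_eval[OF ascent_word_letters[OF Cons.hyps(1)], of i]
    by (simp add: field_simps comp_def)
qed

lemma grothendieck_family_exists: "\<exists>G. grothendieck_family N G"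
proof
  \<comment> \<open>Any word will do, since \<open>groth_eval_word_unique\<close> makes
    \<open>G\<close> independent of the choice; outside the permutations of \<open>{1..N}\<close>
    the value is arbitrary.\<close>
  define W where "W w = (SOME is. ascent_word N is w)" for w
  define G where "G w = groth_eval N (W w) (rvar \<circ> VarA) (rvar \<circ> VarB)" for w
  have W: "ascent_word N (W w) w" if "w permutes {1..N}" for w
    using ascent_word_exists[OF that] unfolding W_def by (metis someI_ex)
  have inj: "inj_on (rvar \<circ> VarA) {1..N}"
    by (simp add: inj_on_def)
  have G: "G w = groth_eval N is (rvar \<circ> VarA) (rvar \<circ> VarB)" if "ascent_word N is w" for "is" w
    unfolding G_def using W ascent_word_permutes[OF that] that inj by (intro groth_eval_word_unique)
  show "grothendieck_family N G"
    unfolding grothendieck_family_def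
  proof (intro conjI allI impI)
    show "G (longest_perm N) =
        (\<Prod>(p, q)\<in>{(p, q). 1 \<le> p \<and> 1 \<le> q \<and> p + q \<le> N}. 1 - rvar (VarB p) / rvar (VarA q))"
      using G[OF ascent_word.Nil] by simp
  next
    fix w i
    assume *: "w permutes {1..N} \<and> 1 \<le> i \<and> i < N \<and> w i < w (i + 1)"
    let ?v = "w \<circ> transpose i (Suc i)"
    have v: "ascent_word N (W ?v) ?v"
      using * by (intro W permutes_compose transpose_permutes) auto
    then have "ascent_word N (i # W ?v) w"
      using * by (intro ascent_word.Cons) auto
    then have "G w = groth_eval N (i # W ?v) (rvar \<circ> VarA) (rvar \<circ> VarB)"
      by (rule G)
    moreover have "rvar (VarA i) - rvar (VarA (Suc i)) \<noteq> (0 :: nat var ratfun)"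
      by simp
    ultimately show "(rvar (VarA i) - rvar (VarA (i + 1))) * G w =
        rvar (VarA i) * G (w \<circ> transpose i (i + 1)) -
        rvar (VarA (i + 1)) * swap_a i (G (w \<circ> transpose i (i + 1)))"
      using G[OF v] swap_a_groth_eval[OF ascent_word_letters[OF v], of i] by simp
  qed
qed

lemma grothendieck_eq:
  assumes "ascent_word N is w"
  shows "grothendieck N w = groth_eval N is (rvar \<circ> VarA) (rvar \<circ> VarB)"
  unfolding grothendieck_def
  using grothendieck_family_exists[of N] grothendieck_family_unique[OF _ assms]
  by (intro the_equality) auto

text \<open>The conditions on \<open>as\<close> keep all denominators nonzero under the
  substitution; \<open>p - 1\<close> passes from positions starting at 1 to list indices starting at
  0.\<close>

lemma grothendieck_at_eq:
  assumes "ascent_word (length as) is w" "distinct as" "0 \<notin> set as"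
  shows "grothendieck_at w as bs =
    groth_eval (length as) is (\<lambda>p. as ! (p - 1)) (\<lambda>p. bs ! (p - 1))"
proof -
  let ?f = "\<lambda>v. case v of VarA p \<Rightarrow> as ! (p - 1) | VarB p \<Rightarrow> bs ! (p - 1) | VarC \<Rightarrow> 0"
  have "inj_on (\<lambda>p. as ! (p - 1)) {1..length as}"
    using assms(2) by (auto simp: inj_on_def nth_eq_iff_index_eq)
  moreover have "as ! (p - 1) \<noteq> 0" if "p \<in> {1..length as}" for p
    using assms(3) that by (metis One_nat_def Suc_le_eq Suc_pred atLeastAtMost_iff nth_mem)
  ultimately show ?thesis
    unfolding grothendieck_at_def grothendieck_eq[OF assms(1)]
    using ratfun_subst_groth_eval[OF ascent_word_letters[OF assms(1)], of ?f "rvar \<circ> VarA" "rvar \<circ> VarB"]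
    by (simp add: ratfun_subst_rvar)
qed

section \<open>Cancellation\<close>

text \<open>For the longest element the factor with index \<open>(y, x)\<close> occurs and vanishes.
  Along an ascent both summands vanish: the induction hypothesis is used at \<open>x\<close> for the
  unchanged point and at the transposed position for the permuted one.\<close>

lemma groth_eval_eq_0:
  assumes "ascent_word N is w" "x \<in> {1..N}" "1 \<le> y" "\<And>q. q \<in> {1..x} \<Longrightarrow> y < w q"
    "a x = b y" "a x \<noteq> 0"
  shows "groth_eval N is a b = 0"
  using assms
proof (induction arbitrary: x a rule: ascent_word.induct)
  case Nil
  have "y < longest_perm N x" using Nil by simp
  then have "(y, x) \<in> {(p, q). 1 \<le> p \<and> 1 \<le> q \<and> p + q \<le> N}"
    using Nil(1,2) by (auto simp: longest_perm_def)
  moreover have "finite {(p, q). 1 \<le> p \<and> 1 \<le> q \<and> p + q \<le> N}"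
    by (rule finite_subset[of _ "{1..N} \<times> {1..N}"]) auto
  moreover have "(\<lambda>(p, q). 1 - b p / a q) (y, x) = 0" using Nil(4,5) by simp
  ultimately show ?case
    unfolding groth_eval.simps by (intro prod_zero bexI[of _ "(y, x)"])
next
  case (Cons "is" w i)
  let ?s = "transpose i (Suc i)"
  have s: "?s x \<in> {1..N}"
    using Cons by (auto simp: transpose_def)
  \<comment> \<open>If the ascent starts at \<open>x\<close> itself, it carries the bound over to
    position \<open>Suc i\<close>.\<close>
  have less: "y < w q" if "q \<in> {1..x} \<or> (x = i \<and> q = Suc i)" for q
    using Cons.prems(3)[of q] Cons.prems(3)[of i] Cons.hyps that by fastforce
  have "y < w (Suc i)" if "i \<le> x"
    using less[of i] that Cons.hyps by simp
  then have "groth_eval N is a b = 0"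
    using Cons.prems less Cons.hyps(3,4) by (intro Cons.IH[of x]) (auto simp: transpose_def)
  moreover have "groth_eval N is (a \<circ> ?s) b = 0"
  proof (rule Cons.IH[OF s \<open>1 \<le> y\<close>])
    fix q
    assume "q \<in> {1..?s x}"
    then show "y < (w \<circ> ?s) q"
      using less[of "?s q"] Cons.hyps by (auto simp: transpose_def split: if_splits)
  qed (use Cons.prems in simp_all)
  ultimately show ?case by simp
qed

text \<open>That \<open>h\<close> is free of \<open>c\<close> is expressed by choosing it before
  \<open>c\<close>. The normalization \<open>h = 1\<close> persists because isobaric divided
  differences fix the constant 1; it later shows that the denominator does not vanish.\<close>

lemma groth_eval_cancel:
  fixes a b :: "nat \<Rightarrow> 'k::field"
  assumes "ascent_word N is w" "x \<in> {1..N}" "w x = y" "\<And>q. q \<in> {1..<x} \<Longrightarrow> y < w q"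
    "inj_on a ({1..N} - {x})"
  obtains h where
    "\<And>c. c \<noteq> 0 \<Longrightarrow> c \<notin> a ` ({1..N} - {x}) \<Longrightarrow> 0 \<notin> a ` ({1..N} - {x}) \<Longrightarrow>
      groth_eval N is (a(x := c)) (b(y := c)) =
      (\<Prod>q\<in>{1..<x}. 1 - c / a q) * (\<Prod>p\<in>{1..<y}. 1 - b p / c) * h"
    "(\<And>p. p \<in> {1..N} - {y} \<Longrightarrow> b p = 0) \<Longrightarrow> h = 1"
proof -
  \<comment> \<open>Both properties are put into one formula with \<open>x\<close> and
    \<open>a\<close> as parameters, since these change in the induction.\<close>
  let ?P = "\<lambda>is x a h. (\<forall>c. c \<noteq> 0 \<longrightarrow> c \<notin> a ` ({1..N} - {x}) \<longrightarrow> 0 \<notin> a ` ({1..N} - {x}) \<longrightarrow>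
      groth_eval N is (a(x := c)) (b(y := c)) =
      (\<Prod>q\<in>{1..<x}. 1 - c / a q) * (\<Prod>p\<in>{1..<y}. 1 - b p / c) * h) \<and>
      ((\<forall>p\<in>{1..N} - {y}. b p = 0) \<longrightarrow> h = 1)"
  have "\<exists>h. ?P is x a h"
    using assms
  proof (induction arbitrary: x a rule: ascent_word.induct)
    case Nil
    let ?T = "{(p, q). 1 \<le> p \<and> 1 \<le> q \<and> p + q \<le> N}"
    define T where "T = {(p, q)\<in>?T. p \<noteq> y \<and> q \<noteq> x}"
    define h where "h = (\<Prod>(p, q)\<in>T. 1 - b p / a q)"
    have xy: "x + y = N + 1" "1 \<le> x" "1 \<le> y" using Nil by (auto simp: longest_perm_def)
    have fin: "finite ?T"
      by (rule finite_subset[of _ "{1..N} \<times> {1..N}"]) auto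
    then have fin': "finite T" by (rule rev_finite_subset) (auto simp: T_def)
    \<comment> \<open>Since \<open>x + y = N + 1\<close>, the pairs with \<open>p = y\<close> are
      those with \<open>q < x\<close>, and the pairs with \<open>q = x\<close> are those with
      \<open>p < y\<close>. The remaining factors involve neither \<open>a x\<close> nor
      \<open>b y\<close>.\<close>
    have T: "?T = {y} \<times> {1..<x} \<union> {1..<y} \<times> {x} \<union> T"
      using xy by (auto simp: T_def)
    have "groth_eval N [] (a(x := c)) (b(y := c)) =
      (\<Prod>q\<in>{1..<x}. 1 - c / a q) * (\<Prod>p\<in>{1..<y}. 1 - b p / c) * h" for c
    proof -
      let ?g = "\<lambda>(p, q). 1 - (b(y := c)) p / (a(x := c)) q"
      have "prod ?g ?T = prod ?g ({y} \<times> {1..<x} \<union> {1..<y} \<times> {x}) * prod ?g T"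
        unfolding T using fin' by (intro prod.union_disjoint) (auto simp: T_def)
      also have "prod ?g ({y} \<times> {1..<x} \<union> {1..<y} \<times> {x}) =
          prod ?g ({y} \<times> {1..<x}) * prod ?g ({1..<y} \<times> {x})"
        by (intro prod.union_disjoint) auto
      also have "prod ?g ({y} \<times> {1..<x}) = (\<Prod>q\<in>{1..<x}. 1 - c / a q)"
        by (subst prod.cartesian_product[symmetric]) (auto intro: prod.cong)
      also have "prod ?g ({1..<y} \<times> {x}) = (\<Prod>p\<in>{1..<y}. 1 - b p / c)"
        by (subst prod.cartesian_product[symmetric]) (auto intro: prod.cong)
      also have "prod ?g T = h"
        unfolding h_def by (rule prod.cong) (auto simp: T_def)
      finally show ?thesis by simp
    qed
    moreover have "h = 1" if "\<forall>p\<in>{1..N} - {y}. b p = 0"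
      unfolding h_def using that by (intro prod.neutral) (auto simp: T_def)
    ultimately show ?case by blast
  next
    case (Cons "is" w i)
    let ?s = "transpose i (Suc i)"
    have "w x \<in> {1..N}"
      using permutes_in_image[OF Cons.hyps(2)] Cons.prems(1) by blast
    then have y: "1 \<le> y" using Cons.prems(2) by simp
    show ?case
    proof (cases "x = i")
      \<comment> \<open>One summand of the recursion vanishes; in the other one the corner has moved to \<open>(x + 1, y)\<close>
        and the new factor \<open>1 - c / a\<^bsub>x+1\<^esub>\<close> cancels against the denominator.\<close>
      case True
      have s: "?s permutes {1..N}"
        using Cons.hyps(3,4) by (rule transpose_permutes)
      have image: "?s ` ({1..N} - {Suc i}) = {1..N} - {x}"
        using permutes_image[OF s] by (simp add: image_set_diff[OF permutes_inj[OF s]] True)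
      have inj: "inj_on (a \<circ> ?s) ({1..N} - {Suc i})"
        using Cons.prems(4) permutes_inj_on[OF s] unfolding image[symmetric] by (rule comp_inj_on[rotated])
      have img: "(a \<circ> ?s) ` ({1..N} - {Suc i}) = a ` ({1..N} - {x})"
        unfolding image[symmetric] by (rule image_comp[symmetric])
      have less: "y < (w \<circ> ?s) q" if "q \<in> {1..<Suc i}" for q
        using that Cons.prems(2,3) Cons.hyps(5) True by (auto simp: transpose_def)
      have "\<exists>h. ?P is (Suc i) (a \<circ> ?s) h"
      proof (rule Cons.IH)
        show "Suc i \<in> {1..N}" using Cons.hyps(4) by simp
        show "(w \<circ> ?s) (Suc i) = y" using Cons.prems(2) True by simp
        show "y < (w \<circ> ?s) q" if "q \<in> {1..<Suc i}" for q using that by (rule less)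
      qed (rule inj)
      then obtain h where h: "?P is (Suc i) (a \<circ> ?s) h" by blast
      have "groth_eval N (i # is) (a(x := c)) (b(y := c)) =
          (\<Prod>q\<in>{1..<x}. 1 - c / a q) * (\<Prod>p\<in>{1..<y}. 1 - b p / c) * h"
        if c: "c \<noteq> 0" "c \<notin> a ` ({1..N} - {x})" "0 \<notin> a ` ({1..N} - {x})" for c
      proof -
        have 1: "groth_eval N is (a(x := c)) (b(y := c)) = 0"
          using less c(1) True
          by (intro groth_eval_eq_0[OF Cons.hyps(1) Cons.prems(1) y]) simp_all
        have upd: "a(x := c) \<circ> ?s = (a \<circ> ?s)(Suc i := c)"
          unfolding True by (auto simp: fun_eq_iff transpose_def)
        have 2: "groth_eval N is (a(x := c) \<circ> ?s) (b(y := c)) =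
          (\<Prod>q\<in>{1..<Suc i}. 1 - c / (a \<circ> ?s) q) * (\<Prod>p\<in>{1..<y}. 1 - b p / c) * h"
          unfolding upd using h c img by simp
        have 3: "(\<Prod>q\<in>{1..<Suc i}. 1 - c / (a \<circ> ?s) q) =
            (\<Prod>q\<in>{1..<x}. 1 - c / a q) * (1 - c / a (Suc i))"
        proof -
          have "(\<Prod>q\<in>{1..<i}. 1 - c / (a \<circ> ?s) q) = (\<Prod>q\<in>{1..<i}. 1 - c / a q)"
            by (rule prod.cong) (auto simp: transpose_def)
          then show ?thesis
            using Cons.hyps(3) True by (simp add: prod.atLeastLessThan_Suc)
        qed
        have ne: "c \<noteq> a (Suc i)" "a (Suc i) \<noteq> 0"
          using c Cons.hyps(4) True by (auto simp: image_iff)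
        have 4: "- (a (Suc i) * (P * (1 - c / a (Suc i)) * Q * h)) / (c - a (Suc i)) = P * Q * h" for P Q
        proof -
          have "c - a (Suc i) \<noteq> 0" using ne by simp
          moreover have "a (Suc i) * (P * (1 - c / a (Suc i)) * Q * h) = - (P * Q * h * (c - a (Suc i)))"
            using ne by (simp add: field_simps)
          ultimately show ?thesis by simp
        qed
        show ?thesis
          unfolding groth_eval.simps 1 2 3 using True 4 by simp
      qed
      then show ?thesis using h by blast
    next
      case False
      \<comment> \<open>An ascent ending at \<open>x\<close> would put a value below
        \<open>y\<close> before position \<open>x\<close>.\<close>
      have x: "x \<noteq> Suc i"
      proof
        assume "x = Suc i"
        then have "y < w i" using Cons.prems(3)[of i] Cons.hyps by simp
        then show False using Cons.hyps(5) Cons.prems(2) \<open>x = Suc i\<close> by simp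
      qed
      then have sx: "?s x = x" using False by simp
      have s: "?s permutes ({1..N} - {x})"
        using Cons.hyps False x by (intro permutes_swap_id) auto
      have img: "(a \<circ> ?s) ` ({1..N} - {x}) = a ` ({1..N} - {x})"
        unfolding image_comp[symmetric] permutes_image[OF s] ..
      have less: "y < (w \<circ> ?s) q" if "q \<in> {1..<x}" for q
      proof -
        have "?s q \<in> {1..<x}"
          using that False x Cons.hyps by (auto simp: transpose_def)
        then show ?thesis using Cons.prems(3) by simp
      qed
      have wsx: "(w \<circ> ?s) x = y" using Cons.prems(2) sx by simp
      have "\<exists>h. ?P is x a h"
        using Cons.IH[OF Cons.prems(1) wsx less Cons.prems(4)] by blast
      then obtain h1 where h1: "?P is x a h1" by blast
      have "inj_on (a \<circ> ?s) ({1..N} - {x})"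
        using Cons.prems(4) permutes_image[OF s] permutes_inj_on[OF s] by (intro comp_inj_on) auto
      then have "\<exists>h. ?P is x (a \<circ> ?s) h"
        using Cons.IH[OF Cons.prems(1) wsx less] by blast
      then obtain h2 where h2: "?P is x (a \<circ> ?s) h2" by blast
      \<comment> \<open>The transposition lies on one side of \<open>x\<close>, so the product over
        \<open>q < x\<close> is invariant under it and the recursion acts on the factors free of
        \<open>c\<close> alone.\<close>
      define h where "h = (a i * h1 - a (Suc i) * h2) / (a i - a (Suc i))"
      have ne: "a i \<noteq> a (Suc i)"
        using Cons.prems(4) Cons.hyps False x by (auto dest: inj_onD)
      have "groth_eval N (i # is) (a(x := c)) (b(y := c)) =
          (\<Prod>q\<in>{1..<x}. 1 - c / a q) * (\<Prod>p\<in>{1..<y}. 1 - b p / c) * h"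
        if c: "c \<noteq> 0" "c \<notin> a ` ({1..N} - {x})" "0 \<notin> a ` ({1..N} - {x})" for c
      proof -
        let ?A = "\<Prod>q\<in>{1..<x}. 1 - c / a q" and ?B = "\<Prod>p\<in>{1..<y}. 1 - b p / c"
        have 1: "groth_eval N is (a(x := c)) (b(y := c)) = ?A * ?B * h1"
          using h1 c by blast
        have upd: "a(x := c) \<circ> ?s = (a \<circ> ?s)(x := c)"
          using False x by (auto simp: fun_eq_iff transpose_def)
        have "(\<Prod>q\<in>{1..<x}. 1 - c / (a \<circ> ?s) q) = ?A"
        proof (cases "i < x")
          case True
          then have "?s permutes {1..<x}"
            using Cons.hyps x by (intro permutes_swap_id) auto
          from prod.permute[OF this, of "\<lambda>q. 1 - c / a q"] show ?thesis by (simp add: comp_def)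
        next
          case False
          then show ?thesis by (intro prod.cong) (auto simp: transpose_def)
        qed
        moreover have "groth_eval N is ((a \<circ> ?s)(x := c)) (b(y := c)) =
            (\<Prod>q\<in>{1..<x}. 1 - c / (a \<circ> ?s) q) * ?B * h2"
          using h2 c unfolding img by blast
        ultimately have 2: "groth_eval N is (a(x := c) \<circ> ?s) (b(y := c)) = ?A * ?B * h2"
          unfolding upd by simp
        have "(a(x := c)) i = a i" "(a(x := c)) (Suc i) = a (Suc i)" using False x by auto
        then show ?thesis
          unfolding groth_eval.simps 1 2 h_def by (simp add: algebra_simps)
      qed
      moreover have "h = 1" if "\<forall>p\<in>{1..N} - {y}. b p = 0"
        using that h1 h2 ne by (simp add: h_def)
      ultimately show ?thesis by blast
    qed
  qed
  then show ?thesis using that by blast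
qed

section \<open>Double quiver polynomials\<close>

text \<open>Common form of the two concatenated alphabets, so that length, distinctness and
  positions are treated once.\<close>

definition blocks :: "(nat \<times> nat \<Rightarrow> 'a) \<Rightarrow> (nat \<Rightarrow> nat) \<Rightarrow> nat list \<Rightarrow> 'a list" where
  "blocks g e is = concat (map (\<lambda>i. map (\<lambda>p. g (i, p)) [1..<e i + 1]) is)"

lemma length_blocks: "length (blocks g e is) = sum_list (map e is)"
  by (induction "is") (simp_all add: blocks_def)

lemma set_blocks: "set (blocks g e is) \<subseteq> range g"
  by (auto simp: blocks_def)

lemma distinct_blocks:
  assumes "distinct is" "inj g"
  shows "distinct (blocks g e is)"
proof -
  have "blocks g e is = map g (concat (map (\<lambda>i. map (Pair i) [1..<e i + 1]) is))"
    by (simp add: blocks_def map_concat comp_def)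
  moreover have "distinct (concat (map (\<lambda>i. map (Pair i) [1..<e i + 1]) is))"
    using assms(1) by (induction "is") (auto simp: distinct_map inj_on_def)
  ultimately show ?thesis
    using assms(2) by (metis distinct_map inj_on_subset subset_UNIV)
qed

text \<open>Locates the two specialized variables in the concatenated alphabets.\<close>

lemma nth_blocks:
  assumes "1 \<le> e i"
  shows "blocks g e (is @ i # js) ! sum_list (map e is) = g (i, 1)"
proof -
  have "blocks g e (is @ i # js) = blocks g e is @ g (i, 1) # map (\<lambda>p. g (i, p)) [2..<e i + 1] @ blocks g e js"
    using assms upt_conv_Cons[of 1 "e i + 1"] by (simp add: blocks_def numeral_2_eq_2 del: upt_Suc)
  then show ?thesis
    by (simp add: nth_append length_blocks)
qed

lemma concat_a_block: "concat (map (a_block e) is) = blocks (rvar \<circ> VarA) e is"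
  and concat_b_block: "concat (map (b_block e) is) = blocks (rvar \<circ> VarB) e is"
  by (simp_all only: blocks_def a_block_def[abs_def] b_block_def[abs_def] comp_apply)

lemma sum_list_map_upt: "sum_list (map e [i..<j]) = sum e {i..<j}"
  by (simp add: interv_sum_list_conv_sum_set_nat)

theorem theorem9p1:
  fixes n i :: nat and r :: "nat \<Rightarrow> nat \<Rightarrow> nat"
    and \<sigma> :: "(nat \<times> nat) var \<Rightarrow> (nat \<times> nat) var ratfun"
  assumes "rank_conditions n r"
    and "i < n"
    and "dim_vec r i \<ge> 1" and "dim_vec r (i + 1) \<ge> 1"
  defines "\<sigma> \<equiv> rvar(VarA (i + 1, 1) := rvar VarC, VarB (i, 1) := rvar VarC)"
  shows "ratfun_subst_defined \<sigma> (quiver_poly n r) \<and> independent_of VarC (ratfun_subst \<sigma> (quiver_poly n r))"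
proof -
  define e where "e = dim_vec r"
  define N where "N = total_dim n r"
  define as where "as = blocks (rvar \<circ> VarA) e (rev [0..<n + 1])"
  define bs where "bs = blocks (rvar \<circ> VarB) e [0..<n + 1]"
  define x y where "x = N + 1 - rank_ext n r (Suc i) 0" and "y = N + 1 - rank_ext n r n i"
  define a b where "a p = as ! (p - 1)" and "b p = bs ! (p - 1)" for p
  have e: "1 \<le> e i" "1 \<le> e (Suc i)" using assms by (simp_all add: e_def)

  \<comment> \<open>Positions of the specialized variables\<close>
  have N: "N = (\<Sum>k\<in>{0..<n + 1}. e k)"
    unfolding N_def total_dim_def e_def by (rule sum.cong) auto
  have x: "x - 1 = (\<Sum>k\<in>{i + 2..<n + 1}. e k)" "x \<in> {1..N}"
  proof -
    have "{0..Suc i} = {0..<i + 2}" by auto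
    then have R: "rank_ext n r (Suc i) 0 = (\<Sum>k\<in>{0..<i + 2}. e k)"
      by (simp only: rank_ext_def e_def) simp
    have "N = (\<Sum>k\<in>{0..<i + 2}. e k) + (\<Sum>k\<in>{i + 2..<n + 1}. e k)"
      unfolding N using assms(2) by (subst sum.atLeastLessThan_concat) auto
    moreover have "1 \<le> (\<Sum>k\<in>{0..<i + 2}. e k)"
      using e by simp
    ultimately show "x - 1 = (\<Sum>k\<in>{i + 2..<n + 1}. e k)" "x \<in> {1..N}"
      unfolding x_def R by auto
  qed
  have y: "y - 1 = (\<Sum>k\<in>{0..<i}. e k)" "y \<in> {1..N}"
  proof -
    have "{i..n} = {i..<n + 1}" by auto
    then have R: "rank_ext n r n i = (\<Sum>k\<in>{i..<n + 1}. e k)"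
      using assms(2) by (simp only: rank_ext_def e_def) simp
    have "N = (\<Sum>k\<in>{0..<i}. e k) + (\<Sum>k\<in>{i..<n + 1}. e k)"
      unfolding N using assms(2) by (subst sum.atLeastLessThan_concat) auto
    moreover have "1 \<le> (\<Sum>k\<in>{i..<n + 1}. e k)"
      using e assms(2) by (simp add: sum.atLeast_Suc_lessThan)
    ultimately show "y - 1 = (\<Sum>k\<in>{0..<i}. e k)" "y \<in> {1..N}"
      unfolding y_def R by auto
  qed

  \<comment> \<open>The alphabets as lists of distinct variables\<close>
  have len: "length as = N" "length bs = N"
    unfolding as_def bs_def length_blocks rev_map[symmetric] sum_list_rev sum_list_map_upt N by simp_all
  have dist: "distinct as" "distinct bs"
    unfolding as_def bs_def by (rule distinct_blocks; simp add: inj_def)+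
  have set: "set as \<subseteq> range (rvar \<circ> VarA)" "set bs \<subseteq> range (rvar \<circ> VarB)"
    unfolding as_def bs_def by (rule set_blocks)+
  have aE: "\<exists>v. a p = rvar (VarA v)" and bE: "\<exists>v. b p = rvar (VarB v)" if "p \<in> {1..N}" for p
  proof -
    have "p - 1 < length as" "p - 1 < length bs" using that len by auto
    then have "a p \<in> set as" "b p \<in> set bs" unfolding a_def b_def by (simp_all only: nth_mem)
    then show "\<exists>v. a p = rvar (VarA v)" "\<exists>v. b p = rvar (VarB v)" using set by auto
  qed
  have a_inj: "a p = a q \<longleftrightarrow> p = q" and b_inj: "b p = b q \<longleftrightarrow> p = q"
    if "p \<in> {1..N}" "q \<in> {1..N}" for p q
    using that len dist by (auto simp: a_def b_def nth_eq_iff_index_eq)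
  have a_x: "a x = rvar (VarA (i + 1, 1))"
  proof -
    have "[0..<n + 1] = [0..<i + 1] @ (i + 1) # [i + 2..<n + 1]"
      using assms(2) upt_add_eq_append[of 0 "i + 1" "n - i"] by (simp add: upt_conv_Cons)
    then have "rev [0..<n + 1] = rev [i + 2..<n + 1] @ (i + 1) # rev [0..<i + 1]" by simp
    moreover have "x - 1 = sum_list (map e (rev [i + 2..<n + 1]))"
      unfolding x rev_map[symmetric] sum_list_rev sum_list_map_upt ..
    moreover have "1 \<le> e (i + 1)" using e by simp
    ultimately show ?thesis
      unfolding a_def as_def by (simp only: nth_blocks comp_apply)
  qed
  have b_y: "b y = rvar (VarB (i, 1))"
  proof -
    have "[0..<n + 1] = [0..<i] @ i # [i + 1..<n + 1]"
      using assms(2) upt_add_eq_append[of 0 i "n + 1 - i"] by (simp add: upt_conv_Cons)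
    moreover have "y - 1 = sum_list (map e [0..<i])"
      unfolding y sum_list_map_upt ..
    ultimately show ?thesis
      unfolding b_def bs_def using e(1) by (simp only: nth_blocks comp_apply)
  qed

  \<comment> \<open>Reduction to evaluations of the recursion\<close>
  interpret r: ranks n r by unfold_locales (rule assms(1))
  \<comment> \<open>The denominator belongs to ranks with the same dimension vector, hence with the
    same \<open>N\<close>, \<open>x\<close> and \<open>y\<close>.\<close>
  interpret m: ranks n "max_ranks e"
    by unfold_locales (use assms(2) in \<open>auto intro: rank_conditions_max_ranks\<close>)

  obtain "is" where "is": "ascent_word N is (zhat_perm n r)"
    using ascent_word_exists[OF r.zhat_perm_permutes] unfolding N_def by blast
  obtain js where js: "ascent_word N js (zhat_perm n (max_ranks e))"
    using ascent_word_exists[OF m.zhat_perm_permutes] unfolding N_def e_def by auto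
  note letters = ascent_word_letters[OF "is"] ascent_word_letters[OF js]
  let ?X = "groth_eval N is" and ?Y = "groth_eval N js"
  have "0 \<notin> set as" using set by (auto dest: sym)
  then have "grothendieck_at w as bs = groth_eval N ks a b" if "ascent_word N ks w" for ks w
    using grothendieck_at_eq[of as ks w bs] that dist(1) unfolding a_def b_def len by simp
  moreover have "quiver_poly n r =
      grothendieck_at (zhat_perm n r) as bs / grothendieck_at (zhat_perm n (max_ranks e)) as bs"
    by (simp only: quiver_poly_def Let_def concat_a_block concat_b_block as_def bs_def e_def)
  ultimately have quiver: "quiver_poly n r = ?X a b / ?Y a b"
    using "is" js by simp

  \<comment> \<open>The specialization as a change of the point\<close>
  let ?c = "rvar VarC" and ?d = "rvar (VarA (i + 1, 1)) :: (nat \<times> nat) var ratfun"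
  have \<sigma>a: "ratfun_subst_defined \<sigma> (a p)" "ratfun_subst \<sigma> (a p) = (a(x := ?c)) p"
    and \<sigma>b: "ratfun_subst_defined \<sigma> (b p)" "ratfun_subst \<sigma> (b p) = (b(y := ?c)) p"
    if p: "p \<in> {1..N}" for p
  proof -
    obtain v where v: "a p = rvar (VarA v)" using aE[OF p] by blast
    obtain u where u: "b p = rvar (VarB u)" using bE[OF p] by blast
    \<comment> \<open>Each variable occurs once in its list, so \<open>\<sigma>\<close> changes
      exactly one entry of each.\<close>
    have "v = (i + 1, 1) \<longleftrightarrow> p = x" "u = (i, 1) \<longleftrightarrow> p = y"
      using a_inj[OF p x(2)] b_inj[OF p y(2)] v u a_x b_y by auto
    then show "ratfun_subst_defined \<sigma> (a p)" "ratfun_subst \<sigma> (a p) = (a(x := ?c)) p"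
      "ratfun_subst_defined \<sigma> (b p)" "ratfun_subst \<sigma> (b p) = (b(y := ?c)) p"
      unfolding v u by (auto simp: ratfun_subst_rvar \<sigma>_def v u)
  qed
  have ac_inj: "inj_on (a(x := ?c)) {1..N}"
    and ac_nz: "p \<in> {1..N} \<Longrightarrow> (a(x := ?c)) p \<noteq> 0" for p
  proof -
    have ne: "a p \<noteq> ?c" "?c \<noteq> a p" "a p \<noteq> 0" if "p \<in> {1..N}" for p
      using aE[OF that] by auto
    show "inj_on (a(x := ?c)) {1..N}"
    proof (rule inj_onI)
      fix p q
      assume "p \<in> {1..N}" "q \<in> {1..N}" "(a(x := ?c)) p = (a(x := ?c)) q"
      then show "p = q"
        using ne[of p] ne[of q] a_inj[of p q] by (simp split: if_splits)
    qed
    show "p \<in> {1..N} \<Longrightarrow> (a(x := ?c)) p \<noteq> 0"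
      using ne(3) by simp
  qed
  have \<sigma>: "ratfun_subst_defined \<sigma> (groth_eval N ks a b) \<and>
      ratfun_subst \<sigma> (groth_eval N ks a b) = groth_eval N ks (a(x := ?c)) (b(y := ?c))"
    if "set ks \<subseteq> {1..<N}" for ks
  proof -
    have "inj_on (\<lambda>p. ratfun_subst \<sigma> (a p)) {1..N}"
      using \<sigma>a(2) ac_inj by (rule inj_on_cong[THEN iffD2])
    moreover have "ratfun_subst \<sigma> (a p) \<noteq> 0" if "p \<in> {1..N}" for p
      using ac_nz[OF that] \<sigma>a(2)[OF that] by simp
    ultimately have "ratfun_subst_defined \<sigma> (groth_eval N ks a b) \<and> ratfun_subst \<sigma> (groth_eval N ks a b) =
        groth_eval N ks (\<lambda>p. ratfun_subst \<sigma> (a p)) (\<lambda>p. ratfun_subst \<sigma> (b p))"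
      using \<sigma>a(1) \<sigma>b(1) by (intro ratfun_subst_groth_eval[OF that]) blast+
    also have "groth_eval N ks (\<lambda>p. ratfun_subst \<sigma> (a p)) (\<lambda>p. ratfun_subst \<sigma> (b p)) =
        groth_eval N ks (a(x := ?c)) (b(y := ?c))"
      using that \<sigma>a(2) \<sigma>b(2) by (rule groth_eval_cong)
    finally show ?thesis .
  qed

  \<comment> \<open>The factors containing \<open>c\<close>\<close>
  have inj: "inj_on a ({1..N} - {x})" using a_inj by (auto simp: inj_on_def)
  have off: "?c \<notin> a ` ({1..N} - {x})" "0 \<notin> a ` ({1..N} - {x})" "?d \<notin> a ` ({1..N} - {x})"
  proof -
    have "a p \<noteq> ?c" "a p \<noteq> 0" "a p \<noteq> ?d" if "p \<in> {1..N} - {x}" for p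
      using aE[of p] a_inj[OF _ x(2), of p] a_x that by auto
    then show "?c \<notin> a ` ({1..N} - {x})" "0 \<notin> a ` ({1..N} - {x})" "?d \<notin> a ` ({1..N} - {x})"
      by (metis imageE)+
  qed
  \<comment> \<open>Cancellation is needed at two values of \<open>c\<close>: the new indeterminate
    and the variable originally at position \<open>x\<close>.\<close>
  have fac: "(\<Prod>q\<in>{1..<x}. 1 - c / a q) * (\<Prod>p\<in>{1..<y}. 1 - b p / c) \<noteq> 0" if "c = ?c \<or> c = ?d" for c
  proof -
    have "1 - c / a q \<noteq> 0" if "q \<in> {1..<x}" for q
    proof -
      have "a q \<in> a ` ({1..N} - {x})" using that x(2) by auto
      then have "a q \<noteq> 0" "a q \<noteq> c" using off \<open>c = ?c \<or> c = ?d\<close> by auto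
      then show ?thesis by simp
    qed
    moreover have "1 - b p / c \<noteq> 0" if "p \<in> {1..<y}" for p
      using bE[of p] that y(2) \<open>c = ?c \<or> c = ?d\<close> by auto
    ultimately show ?thesis
      unfolding mult_eq_0_iff prod_zero_iff[OF finite_atLeastLessThan] by blast
  qed

  \<comment> \<open>The denominator\<close>
  have corner: "zhat_perm n (max_ranks e) x = y"
    and js_less: "\<And>q. q \<in> {1..<x} \<Longrightarrow> y < zhat_perm n (max_ranks e) q"
  proof -
    have "{i..Suc i} = {i, Suc i}" by auto
    then have "1 \<le> max_ranks e i (Suc i)" using e by (simp add: max_ranks_def)
    then show "zhat_perm n (max_ranks e) x = y"
      using m.zhat_perm_corner[of i] assms(2) e
      by (simp add: x_def y_def N_def e_def rank_ext_low_max_ranks)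
    show "y < zhat_perm n (max_ranks e) q" if "q \<in> {1..<x}" for q
      using m.zhat_perm_ge(1)[of i q] that assms(2) e
      by (simp add: x_def y_def N_def e_def rank_ext_low_max_ranks)
  qed
  obtain h where h: "\<And>c. c \<noteq> 0 \<Longrightarrow> c \<notin> a ` ({1..N} - {x}) \<Longrightarrow> ?Y (a(x := c)) (b(y := c)) =
      (\<Prod>q\<in>{1..<x}. 1 - c / a q) * (\<Prod>p\<in>{1..<y}. 1 - b p / c) * h"
    using groth_eval_cancel[OF js x(2) corner js_less inj, of b] off(2) by metis
  have Y: "?Y (a(x := ?c)) (b(y := ?c)) \<noteq> 0"
  proof
    assume *: "?Y (a(x := ?c)) (b(y := ?c)) = 0"
    \<comment> \<open>\<open>?f\<close> kills the variables \<open>VarB\<close> but keeps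
      \<open>VarC\<close>; thus the entry of \<open>b\<close> at \<open>y\<close> remains
      \<open>c\<close>, and \<open>groth_eval_cancel\<close> applies again with all other entries
      \<open>0\<close>.\<close>
    let ?f = "\<lambda>v :: (nat \<times> nat) var. case v of VarB _ \<Rightarrow> 0 | _ \<Rightarrow> rvar v"
    have fa: "ratfun_subst_defined ?f ((a(x := ?c)) p) \<and> ratfun_subst ?f ((a(x := ?c)) p) = (a(x := ?c)) p"
      and fb: "ratfun_subst_defined ?f ((b(y := ?c)) p) \<and> ratfun_subst ?f ((b(y := ?c)) p) = ((\<lambda>_. 0)(y := ?c)) p"
      if "p \<in> {1..N}" for p
      using aE[OF that] bE[OF that] by (auto simp: ratfun_subst_rvar)
    have "inj_on (\<lambda>p. ratfun_subst ?f ((a(x := ?c)) p)) {1..N}"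
      by (rule inj_on_cong[THEN iffD2, OF _ ac_inj]) (use fa in blast)
    moreover have "ratfun_subst_defined ?f ((a(x := ?c)) p) \<and> ratfun_subst ?f ((a(x := ?c)) p) \<noteq> 0"
      if "p \<in> {1..N}" for p
      unfolding fa[OF that, THEN conjunct2] using fa[OF that] ac_nz[OF that] by blast
    moreover have "ratfun_subst_defined ?f ((b(y := ?c)) p)" if "p \<in> {1..N}" for p
      using fb[OF that] by blast
    ultimately have "ratfun_subst ?f (?Y (a(x := ?c)) (b(y := ?c))) =
        ?Y (\<lambda>p. ratfun_subst ?f ((a(x := ?c)) p)) (\<lambda>p. ratfun_subst ?f ((b(y := ?c)) p))"
      by (intro ratfun_subst_groth_eval[OF letters(2), THEN conjunct2])
    also have "\<dots> = ?Y (a(x := ?c)) ((\<lambda>_. 0)(y := ?c))"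
      by (rule groth_eval_cong[OF letters(2)]) (use fa fb in blast)+
    also have "\<dots> = (\<Prod>q\<in>{1..<x}. 1 - ?c / a q)"
    proof -
      obtain h' where h': "?Y (a(x := ?c)) ((\<lambda>_. 0)(y := ?c)) =
          (\<Prod>q\<in>{1..<x}. 1 - ?c / a q) * (\<Prod>p\<in>{1..<y}. 1 - 0 / ?c) * h'" "h' = 1"
        using groth_eval_cancel[OF js x(2) corner js_less inj, of "\<lambda>_. 0"] off(1,2) rvar_nonzero by metis
      then show ?thesis by simp
    qed
    finally show False using * ratfun_subst_0[of ?f] fac[of ?c] by simp
  qed
  have defined: "ratfun_subst_defined \<sigma> (quiver_poly n r)"
    and subst: "ratfun_subst \<sigma> (quiver_poly n r) =
      ?X (a(x := ?c)) (b(y := ?c)) / ?Y (a(x := ?c)) (b(y := ?c))"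
    unfolding quiver using ratfun_subst_divide[of \<sigma> "?X a b" "?Y a b"] \<sigma>[OF letters(1)] \<sigma>[OF letters(2)] Y by simp_all

  \<comment> \<open>The numerator and the quotient\<close>
  have less: "y < zhat_perm n r q" if "q \<in> {1..<x}" for q
    using r.zhat_perm_ge(1)[of i q] that assms(2) e by (simp add: x_def y_def N_def e_def)
  have "y \<le> zhat_perm n r x"
    using r.zhat_perm_ge(2)[of i] assms(2) e by (simp add: x_def y_def N_def e_def)
  then consider "zhat_perm n r x = y" | "y < zhat_perm n r x" by linarith
  then have "independent_of VarC (?X (a(x := ?c)) (b(y := ?c)) / ?Y (a(x := ?c)) (b(y := ?c)))"
  proof cases
    case 1
    obtain k where k: "\<And>c. c \<noteq> 0 \<Longrightarrow> c \<notin> a ` ({1..N} - {x}) \<Longrightarrow> ?X (a(x := c)) (b(y := c)) =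
        (\<Prod>q\<in>{1..<x}. 1 - c / a q) * (\<Prod>p\<in>{1..<y}. 1 - b p / c) * k"
      using groth_eval_cancel[OF "is" x(2) 1 less inj, of b] off(2) by metis
    \<comment> \<open>The common nonzero factor cancels, which leaves a quotient that is the same
      for both values of \<open>c\<close>.\<close>
    have "?X (a(x := c)) (b(y := c)) / ?Y (a(x := c)) (b(y := c)) = k / h" if "c = ?c \<or> c = ?d" for c
      using h[of c] k[of c] fac[OF that] that off by auto
    \<comment> \<open>\<open>c\<close> may be replaced by the original variable \<open>a\<^sub>x\<close>.\<close>
    then have "?X (a(x := ?c)) (b(y := ?c)) / ?Y (a(x := ?c)) (b(y := ?c)) =
        ?X (a(x := ?d)) (b(y := ?d)) / ?Y (a(x := ?d)) (b(y := ?d))"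
      by metis
    moreover have "independent_of VarC (groth_eval N ks (a(x := ?d)) (b(y := ?d)))"
      if "set ks \<subseteq> {1..<N}" for ks
    proof (rule independent_of_groth_eval[OF that])
      fix p
      assume "p \<in> {1..N}"
      from aE[OF this] bE[OF this]
      show "independent_of VarC ((a(x := ?d)) p)" "independent_of VarC ((b(y := ?d)) p)"
        by (auto intro: independent_of_rvar)
    qed
    ultimately show ?thesis
      using letters by (simp only: independent_of_divide)
  next
    case 2
    then have "y < zhat_perm n r q" if "q \<in> {1..x}" for q
      using less[of q] that by (cases "q = x") auto
    then have "?X (a(x := ?c)) (b(y := ?c)) = 0"
      using x(2) y(2) by (intro groth_eval_eq_0[OF "is", of x y]) auto
    then show ?thesis by (simp add: independent_of_0)
  qed
  with defined subst show ?thesis by simp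
qed

end
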